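(* Let $n$ be a positive integer and $\mathbb{K}$ be a commutative field. A matrix $A \in M_{n}(\mathbb{K})$ can be written as a product $A=NV$ of a nilpotent matrix $N\in M_n(\mathbb{K})$ and an idempotent matrix $V\in M_n(\mathbb{K})$ if and only if the first nontrivial invariant factor of $A$ has $0$ as a root.
   Context: A matrix $V\in M_n(\mathbb{K})$ is idempotent if $V^2=V$. The invariant factors of $A \in M_n(\mathbb{K})$ are the unique $n$-tuple of monic polynomials $(P_1,\ldots,P_n)$ in $\mathbb{K}[X]$ with $P_1 \mid P_2 \mid \cdots \mid P_n$ such that $A$ is similar to the block diagonal matrix $\mathrm{diag}(C(P_1),\ldots,C(P_n))$, where $C(P)$ is the companion matrix of $P$ and $C(1)$ is the empty matrix. An invariant factor is nontrivial if it is different from $1$; the first nontrivial invariant factor is $P_v$ where $v$ is the smallest index with $P_v\neq 1$. *)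

theory Defs
  imports "HOL-Computational_Algebra.Polynomial" "Jordan_Normal_Form.Matrix"
begin

definition nilpotent_mat :: "'a :: semiring_1 mat \<Rightarrow> bool" where
  "nilpotent_mat N \<longleftrightarrow> square_mat N \<and> (\<exists>k. N ^\<^sub>m k = 0\<^sub>m (dim_row N) (dim_row N))"

definition idempotent_mat :: "'a :: semiring_1 mat \<Rightarrow> bool" where
  "idempotent_mat V \<longleftrightarrow> square_mat V \<and> V ^\<^sub>m 2 = V"

(* Convention: ones on the subdiagonal, negated coefficients of P in the last column.
   Intended for monic P; the companion matrix of 1 is the empty (0 x 0) matrix. *)
definition companion_mat :: "'a :: field poly \<Rightarrow> 'a mat" where
  "companion_mat P = mat (degree P) (degree P)
     (\<lambda>(i, j). if j = degree P - 1 then - coeff P i else if i = j + 1 then 1 else 0)"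

definition is_invariant_factors :: "'a :: field mat \<Rightarrow> 'a poly list \<Rightarrow> bool" where
  "is_invariant_factors A Ps \<longleftrightarrow>
     length Ps = dim_row A \<and>
     (\<forall>P \<in> set Ps. lead_coeff P = 1) \<and>
     (\<forall>i. Suc i < length Ps \<longrightarrow> Ps ! i dvd Ps ! Suc i) \<and>
     similar_mat A (diag_block_mat (map companion_mat Ps))"

(* Entry i of the list (counted from 0) is the factor usually written P_(i+1).
   The description is proper for square A, by the rational canonical form theorem. *)
definition invariant_factors :: "'a :: field mat \<Rightarrow> 'a poly list" where
  "invariant_factors A = (THE Ps. is_invariant_factors A Ps)"

(* Only meaningful if some invariant factor differs from 1, which is the case for every
   square matrix of positive size, since the degrees of the factors add up to the size. *)
definition first_nontrivial_invariant_factor :: "'a :: field mat \<Rightarrow> 'a poly" where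
  "first_nontrivial_invariant_factor A =
     (let Ps = invariant_factors A in Ps ! (LEAST v. v < length Ps \<and> Ps ! v \<noteq> 1))"

end

(* The rank of Q(A) at the companion matrix of P is deg P - deg gcd(P, Q), so the invariant factors
   P_1 | ... | P_n of A satisfy n - rank Q(A) = sum_j deg gcd(P_j, Q) for every Q. Taking Q = P_i for
   i = 1, 2, ... shows that they are unique. For existence, take d maximal such that some vector x and
   linear form phi satisfy phi(A^i x) = 0 for i < d - 1 and phi(A^(d-1) x) = 1. The span of the A^i x
   is then cyclic with an invariant complement, the common kernel of the phi A^i, which is annihilated
   by the polynomial of A on x.

   If P(0) = 0, the companion matrix of P is the product of the nilpotent companion matrix of X^d and
   an idempotent matrix. Conversely let A = N V, let P be the first nontrivial invariant factor, of
   degree m, and r the number of nontrivial ones. Then A - N = - N (1 - V) has rank at most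
   k = n - rank V <= n - rank A. By the telescoping formula for A^q - N^q, the image of A^q is
   contained in the A-invariant subspace generated by k vectors, which modulo the image of P(A) has
   dimension at most m k. If P(0) were nonzero, P(A) and A^q together would generate the whole space,
   whose quotient by the image of P(A) has dimension r m, so r <= k. But n - rank A, the number of
   invariant factors with root 0, would be at most r - 1. *)

theory Submission
  imports Defs "Jordan_Normal_Form.Determinant"
begin

text \<open>Subspaces and quotients never appear as objects. A comparison of dimensions always ends
  in an identity matrix of size r written as a product through size k, which forces r \<le> k;
  ranks, complements and generated subspaces are therefore carried by rectangular factorizations. A
  vector of maximal cyclic length alone would leave an invariant complement to be found. The linear
  form of the pair supplies it, and maximality is used twice: for A, to obtain an annihilator of the
  vector, and for the transposed matrix, to obtain an annihilator of the form, which makes the joint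
  kernel invariant. In the converse, the first nontrivial factor P is singled out because it divides
  all later ones: each of the r nontrivial blocks then leaves a full copy of the polynomials modulo
  P. A later factor of larger degree would leave smaller quotients on the earlier blocks, and the
  comparison with m k would no longer bound r by k. The contradiction rests on one block, that of P
  itself, which has trivial kernel if P(0) is nonzero.\<close>

text \<open>The library states these laws with \<^const>\<open>carrier_mat\<close> premises; the simplifier cannot
  guess their dimension parameters, but it can compare dimensions.\<close>

lemma mult_assoc_dim: 
  fixes A :: "'a :: semiring_0 mat"
  shows "dim_col A = dim_row B \<Longrightarrow> dim_col B = dim_row C \<Longrightarrow> A * B * C = A * (B * C)"
  by (rule assoc_mult_mat) auto

lemma distrib_left_dim:
  fixes A :: "'a :: semiring_0 mat"
  shows "dim_col A = dim_row B \<Longrightarrow> dim_row B = dim_row C \<Longrightarrow> dim_col B = dim_col C \<Longrightarrow>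
    A * (B + C) = A * B + A * C"
  by (rule mult_add_distrib_mat) auto

lemma distrib_right_dim:
  fixes A :: "'a :: semiring_0 mat"
  shows "dim_col A = dim_row C \<Longrightarrow> dim_row A = dim_row B \<Longrightarrow> dim_col A = dim_col B \<Longrightarrow>
    (A + B) * C = A * C + B * C"
  by (rule add_mult_distrib_mat) auto

lemma distrib_minus_left_dim:
  fixes A :: "'a :: ring mat"
  shows "dim_col A = dim_row B \<Longrightarrow> dim_row B = dim_row C \<Longrightarrow> dim_col B = dim_col C \<Longrightarrow>
    A * (B - C) = A * B - A * C"
  by (rule mult_minus_distrib_mat) auto

lemma distrib_minus_right_dim:
  fixes A :: "'a :: ring mat"
  shows "dim_col A = dim_row C \<Longrightarrow> dim_row A = dim_row B \<Longrightarrow> dim_col A = dim_col B \<Longrightarrow>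
    (A - B) * C = A * C - B * C"
  by (rule minus_mult_distrib_mat) auto

lemma zero_mult_dim:
  fixes A :: "'a :: semiring_0 mat"
  shows "dim_row A = m \<Longrightarrow> 0\<^sub>m n m * A = 0\<^sub>m n (dim_col A)"
    "dim_col A = m \<Longrightarrow> A * 0\<^sub>m m n = 0\<^sub>m (dim_row A) n"
  by auto

lemma one_mult_dim:
  fixes A :: "'a :: semiring_1 mat"
  shows "dim_row A = n \<Longrightarrow> 1\<^sub>m n * A = A" "dim_col A = n \<Longrightarrow> A * 1\<^sub>m n = A"
  by auto

lemma cancel_left_dim:
  fixes A :: "'a :: semiring_1 mat"
  shows "A * B = 1\<^sub>m n \<Longrightarrow> dim_col A = dim_row B \<Longrightarrow> dim_row C = n \<Longrightarrow> dim_col B = n \<Longrightarrow>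
    A * (B * C) = C"
  by (metis mult_assoc_dim one_mult_dim(1))

lemma add_zero_dim:
  fixes A :: "'a :: monoid_add mat"
  shows "dim_row A = n \<Longrightarrow> dim_col A = m \<Longrightarrow> 0\<^sub>m n m + A = A"
    "dim_row A = n \<Longrightarrow> dim_col A = m \<Longrightarrow> A + 0\<^sub>m n m = A"
  by auto

lemma minus_self_dim:
  fixes A :: "'a :: ab_group_add mat"
  shows "A - A = 0\<^sub>m (dim_row A) (dim_col A)" 
    "dim_row A = n \<Longrightarrow> dim_col A = m \<Longrightarrow> A - 0\<^sub>m n m = A"
  by auto

lemma minus_add_dim:
  fixes A :: "'a :: ab_group_add mat"
  shows "dim_row A = dim_row B \<Longrightarrow> dim_col A = dim_col B \<Longrightarrow> A + (B - A) = B"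
  by auto

lemmas mat_dim = mult_assoc_dim distrib_left_dim distrib_right_dim distrib_minus_left_dim
  distrib_minus_right_dim zero_mult_dim one_mult_dim add_zero_dim minus_self_dim

section \<open>Juxtaposition of matrices by columns and by rows\<close>

definition append_cols :: "'a :: zero mat \<Rightarrow> 'a mat \<Rightarrow> 'a mat" where
  "append_cols A B = four_block_mat A B (0\<^sub>m 0 (dim_col A)) (0\<^sub>m 0 (dim_col B))"

lemma dim_append [simp]:
  "dim_row (append_cols A B) = dim_row A" "dim_col (append_cols A B) = dim_col A + dim_col B"
  "dim_row (A @\<^sub>r B) = dim_row A + dim_row B" "dim_col (A @\<^sub>r B) = dim_col A"
  by (auto simp: append_cols_def append_rows_def)

lemma carrier_append_cols [simp, intro]:
  "A \<in> carrier_mat n m1 \<Longrightarrow> B \<in> carrier_mat n m2 \<Longrightarrow>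
    append_cols A B \<in> carrier_mat n (m1 + m2)"
  by (auto simp: append_cols_def)

lemma mult_append_cols:
  fixes C :: "'a :: semiring_0 mat"
  assumes "dim_row A = dim_col C" "dim_row B = dim_col C"
  shows "C * append_cols A B = append_cols (C * A) (C * B)"
  using assms by (intro eq_matI) (auto simp: append_cols_def scalar_prod_def)

lemma append_rows_mult_append_cols:
  fixes A :: "'a :: semiring_0 mat"
  assumes "dim_col A = dim_row C" "dim_col B = dim_row C" "dim_row C = dim_row D"
  shows "(A @\<^sub>r B) * append_cols C D = four_block_mat (A * C) (A * D) (B * C) (B * D)"
  using assms by (intro eq_matI) (auto simp: append_cols_def append_rows_def scalar_prod_def)

lemma append_cols_mult_append_rows:
  fixes A :: "'a :: semiring_0 mat"
  assumes "dim_col A = dim_row C" "dim_col B = dim_row D" "dim_row A = dim_row B"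
    "dim_col C = dim_col D"
  shows "append_cols A B * (C @\<^sub>r D) = A * C + B * D"
proof (rule eq_matI, goal_cases)
  case (1 i j)
  let ?p = "dim_row C" and ?q = "dim_row D"
  have shift: "sum g {?p..<?p + ?q} = (\<Sum>k = 0..<?q. g (k + ?p))" for g :: "nat \<Rightarrow> 'a"
    using sum.shift_bounds_nat_ivl[of g 0 ?p ?q] by (simp add: add.commute)
  let ?g = "\<lambda>k. append_cols A B $$ (i, k) * (C @\<^sub>r D) $$ (k, j)"
  have "(append_cols A B * (C @\<^sub>r D)) $$ (i, j) = sum ?g {0..<?p + ?q}"
    using 1 assms by (simp add: scalar_prod_def)
  also have "\<dots> = sum ?g {0..<?p} + sum ?g {?p..<?p + ?q}"
    by (simp add: sum.atLeastLessThan_concat)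
  also have "\<dots> = sum ?g {0..<?p} + (\<Sum>k = 0..<?q. ?g (k + ?p))"
    unfolding shift ..
  also have "\<dots> = (A * C + B * D) $$ (i, j)"
    using 1 assms by (auto simp: append_cols_def append_rows_def scalar_prod_def)
  finally show ?case .
qed (use assms in auto)

section \<open>Rank factorizations\<close>

text \<open>Padding \<open>X\<close> with zero columns and \<open>Y\<close> with zero rows up to
  square size turns a one-sided inverse into a two-sided one, but \<open>Y' * X'\<close> has a zero
  row if k < r. All comparisons of dimensions reduce to this.\<close>

lemma one_mat_factor_le:
  fixes X :: "'a :: field mat"
  assumes X: "X \<in> carrier_mat r k" and Y: "Y \<in> carrier_mat k r" and XY: "X * Y = 1\<^sub>m r"
  shows "r \<le> k"
proof (rule ccontr)
  assume "\<not> r \<le> k"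
  define X' where "X' = append_cols X (0\<^sub>m r (r - k))"
  define Y' where "Y' = Y @\<^sub>r 0\<^sub>m (r - k) r"
  have c: "X' \<in> carrier_mat r r" "Y' \<in> carrier_mat r r"
    using X Y \<open>\<not> r \<le> k\<close> by (auto simp: X'_def Y'_def)
  have "X' * Y' = 1\<^sub>m r"
    unfolding X'_def Y'_def using X Y XY
    by (subst append_cols_mult_append_rows) (auto simp: mat_dim)
  then have "Y' * X' = 1\<^sub>m r"
    using mat_mult_left_right_inverse c by blast
  then have "(Y' * X') $$ (k, k) = 1"
    using \<open>\<not> r \<le> k\<close> by simp
  moreover have "(Y' * X') $$ (k, k) = 0"
    using c X Y \<open>\<not> r \<le> k\<close> by (auto simp: scalar_prod_def Y'_def append_rows_def)
  ultimately show False by simp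
qed

text \<open>A full rank factorization: \<open>X\<close> is injective with left inverse
  \<open>L\<close>, and \<open>Y\<close> is surjective with right inverse \<open>R\<close>. Keeping
  the one-sided inverses as witnesses lets ranks pass through products and similarities by
  calculation alone.\<close>

definition has_rank :: "'a :: field mat \<Rightarrow> nat \<Rightarrow> bool" where
  "has_rank M r \<longleftrightarrow> (\<exists>X Y L R. X \<in> carrier_mat (dim_row M) r \<and> Y \<in> carrier_mat r (dim_col M) \<and>
     L \<in> carrier_mat r (dim_row M) \<and> R \<in> carrier_mat (dim_col M) r \<and>
     M = X * Y \<and> L * X = 1\<^sub>m r \<and> Y * R = 1\<^sub>m r)"

lemma has_rankE:
  assumes "has_rank M r" "M \<in> carrier_mat n m"
  obtains X Y L R where "X \<in> carrier_mat n r" "Y \<in> carrier_mat r m"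
    "L \<in> carrier_mat r n" "R \<in> carrier_mat m r" "M = X * Y" "L * X = 1\<^sub>m r" "Y * R = 1\<^sub>m r"
  using assms by (auto simp: has_rank_def)

text \<open>Multiplying \<open>U * V = X * Y\<close> by \<open>L\<close> on the left and by
  \<open>R\<close> on the right exhibits the identity of size \<open>r\<close> as a product through
  size \<open>k\<close>.\<close>

lemma has_rank_le:
  assumes "has_rank M r" "M = U * V" "U \<in> carrier_mat n k" "V \<in> carrier_mat k m"
  shows "r \<le> k"
proof -
  have "M \<in> carrier_mat n m" using assms by auto
  then obtain X Y L R where c: "X \<in> carrier_mat n r" "Y \<in> carrier_mat r m"
    "L \<in> carrier_mat r n" "R \<in> carrier_mat m r" and M: "M = X * Y" "L * X = 1\<^sub>m r" "Y * R = 1\<^sub>m r"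
    using has_rankE[OF assms(1)] by metis
  have UV: "U * V = X * Y" using M assms(2) by simp
  have "(L * U) * (V * R) = L * (U * V * R)"
    using c assms(3,4) by (simp add: mat_dim)
  also have "\<dots> = 1\<^sub>m r"
    unfolding UV using c M(2,3) by (simp add: mat_dim)
  finally show ?thesis
    using c assms(3,4) by (intro one_mat_factor_le[of "L * U" _ _ "V * R"]) auto
qed

lemma has_rank_unique:
  assumes "has_rank M r" "has_rank M s"
  shows "r = s"
proof (rule antisym)
  show "r \<le> s"
    using assms(2) has_rank_le[OF assms(1)] unfolding has_rank_def by metis
  show "s \<le> r"
    using assms(1) has_rank_le[OF assms(2)] unfolding has_rank_def by metis
qed

text \<open>A largest identity matrix of the form \<^term>\<open>L * M * R\<close> forces
  \<^term>\<open>M * R * L * M = M\<close>, since a nonzero entry of the difference could be used to enlarge it.\<close>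

lemma ex_has_rank: "\<exists>r. has_rank M r"
proof -
  let ?n = "dim_row M" and ?m = "dim_col M"
  define P where "P r \<longleftrightarrow> (\<exists>L R. L \<in> carrier_mat r ?n \<and> R \<in> carrier_mat ?m r \<and> L * (M * R) = 1\<^sub>m r)" for r
  have "P 0"
    unfolding P_def by (intro exI[of _ "0\<^sub>m 0 ?n"] exI[of _ "0\<^sub>m ?m 0"]) auto
  moreover have "r \<le> ?n" if P: "P r" for r
  proof -
    from P obtain L R where "L \<in> carrier_mat r ?n" "R \<in> carrier_mat ?m r" "L * (M * R) = 1\<^sub>m r"
      unfolding P_def by blast
    then show ?thesis by (intro one_mat_factor_le[of L r ?n "M * R"]) auto
  qed
  ultimately obtain r where r: "P r" "\<not> P (Suc r)"
    using nat_induct[of P "Suc ?n"] not_less_eq_eq by blast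
  then obtain L R where c: "L \<in> carrier_mat r ?n" "R \<in> carrier_mat ?m r" and LR: "L * (M * R) = 1\<^sub>m r"
    unfolding P_def by blast
  have cancel: "L * (M * (R * C)) = C" if "dim_row C = r" for C
    using cancel_left_dim[OF LR, of C] c that by (simp add: mat_dim)
  define E where "E = M - M * (R * (L * M))"
  have E: "E \<in> carrier_mat ?n ?m"
    using c by (auto simp: E_def)
  have "E = 0\<^sub>m ?n ?m"
  proof (rule ccontr)
    assume "E \<noteq> 0\<^sub>m ?n ?m"
    then obtain i j where ij: "i < ?n" "j < ?m" "E $$ (i, j) \<noteq> 0"
      using E by (metis carrier_matD eq_matI index_zero_mat)
    define e where "e = mat 1 ?n (\<lambda>(_, k). if k = i then 1 else 0 :: 'a)"
    define f where "f = mat ?m 1 (\<lambda>(k, _). if k = j then inverse (E $$ (i, j)) else 0)"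
    \<comment> \<open>The row \<open>e\<close> and the column \<open>f\<close> point at the nonzero
      entry of \<open>E\<close>. They are corrected here so that \<open>l * M * R\<close> and
      \<open>L * M * \<rho>\<close> vanish; the scaling in \<open>f\<close> makes
      \<open>l * M * \<rho>\<close> equal to 1, so \<open>L\<close> and \<open>R\<close> can be
      enlarged by \<open>l\<close> and \<open>\<rho>\<close>.\<close>
    define l where "l = e * (1\<^sub>m ?n - M * (R * L))"
    define \<rho> where "\<rho> = (1\<^sub>m ?m - R * (L * M)) * f"
    have d: "dim_row e = 1" "dim_col e = ?n" "dim_row f = ?m" "dim_col f = 1"
      "dim_row L = r" "dim_col L = ?n" "dim_row R = ?m" "dim_col R = r"
      using c by (auto simp: e_def f_def)
    have cl: "l \<in> carrier_mat 1 ?n" "\<rho> \<in> carrier_mat ?m 1"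
      using c by (auto simp: l_def \<rho>_def e_def f_def)
    have 1: "L * (M * \<rho>) = 0\<^sub>m r 1"
      using d LR by (simp add: \<rho>_def mat_dim cancel)
    have 2: "l * (M * R) = 0\<^sub>m 1 r"
      using d LR by (simp add: l_def mat_dim cancel)
    have "l * (M * \<rho>) = e * (E * f)"
      using d LR by (simp add: l_def \<rho>_def E_def mat_dim cancel)
    also have "\<dots> = 1\<^sub>m 1"
    proof (rule eq_matI, goal_cases)
      case (1 i' j')
      have delta: "(\<Sum>k = 0..<q. g k * (if k = p then c else 0)) = g p * c"
        "(\<Sum>k = 0..<q. (if k = p then c else 0) * g k) = c * g p"
        if "p < q" for p q :: nat and c :: 'a and g
        using that by (simp_all add: if_distrib[of "(*) _"] if_distrib[of "\<lambda>x. x * _"] cong: if_cong)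
      have f: "(E * f) $$ (k, 0) = E $$ (k, j) * inverse (E $$ (i, j))" if "k < ?n" for k
        using carrier_matD[OF E] ij(2) that by (simp add: f_def scalar_prod_def delta)
      define G where "G = E * f"
      have dG: "dim_row G = ?n" "dim_col G = 1"
        using E d by (auto simp: G_def)
      have "(e * G) $$ (0, 0) = (\<Sum>k = 0..<?n. (if k = i then 1 else 0) * G $$ (k, 0))"
        using d(1,2) dG by (simp add: scalar_prod_def e_def)
      also have "\<dots> = 1"
        using ij by (simp add: delta G_def f del: index_mult_mat(1))
      finally show ?case
        using 1 unfolding G_def by simp
    qed (use d in simp_all)
    finally have 3: "l * (M * \<rho>) = 1\<^sub>m 1" .
    have "(L @\<^sub>r l) * (M * append_cols R \<rho>) = four_block_mat (1\<^sub>m r) (0\<^sub>m r 1) (0\<^sub>m 1 r) (1\<^sub>m 1)"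
      using d carrier_matD[OF cl(1)] carrier_matD[OF cl(2)]
      by (simp only: mult_append_cols append_rows_mult_append_cols 1 2 3 LR index_mult_mat)
    then have "(L @\<^sub>r l) * (M * append_cols R \<rho>) = 1\<^sub>m (Suc r)"
      by simp
    moreover have "L @\<^sub>r l \<in> carrier_mat (Suc r) ?n" "append_cols R \<rho> \<in> carrier_mat ?m (Suc r)"
      using c cl by auto
    ultimately have "P (Suc r)" unfolding P_def by blast
    with r show False by simp
  qed
  then have "M * (R * (L * M)) = M"
    using minus_add_dim[of "M * (R * (L * M))" M] c by (simp add: E_def mat_dim)
  \<comment> \<open>The factors are \<open>M * R\<close> and \<open>L * M\<close>; the same
    \<open>L\<close> and \<open>R\<close> serve as their one-sided inverses.\<close>
  then have "M = (M * R) * (L * M)"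
    using c by (simp add: mat_dim)
  moreover have "L * (M * R) = 1\<^sub>m r" "(L * M) * R = 1\<^sub>m r"
    using LR c by (simp_all add: mat_dim)
  moreover have "M * R \<in> carrier_mat ?n r" "L * M \<in> carrier_mat r ?m"
    using c by auto
  ultimately show ?thesis
    unfolding has_rank_def using c(1,2) by blast
qed

text \<open>\<open>X * Y\<close> is a projection because \<open>Y * X\<close> is the identity, and a
  rank factorization of the complementary projection gives \<open>Z\<close> and \<open>W\<close>.
  This replaces the extension of a basis.\<close>

lemma right_inverse_completion:
  fixes X :: "'a :: field mat"
  assumes X: "X \<in> carrier_mat n s" and Y: "Y \<in> carrier_mat s n" and YX: "Y * X = 1\<^sub>m s"
  obtains Z W where "Z \<in> carrier_mat n (n - s)" "W \<in> carrier_mat (n - s) n"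
    "X * Y + Z * W = 1\<^sub>m n" "W * Z = 1\<^sub>m (n - s)" "Y * Z = 0\<^sub>m s (n - s)" "W * X = 0\<^sub>m (n - s) s"
    "s \<le> n"
proof -
  obtain k where "has_rank (1\<^sub>m n - X * Y) k"
    using ex_has_rank by blast
  then obtain Z W L R where c: "Z \<in> carrier_mat n k" "W \<in> carrier_mat k n" "L \<in> carrier_mat k n"
    "R \<in> carrier_mat n k" and E: "1\<^sub>m n - X * Y = Z * W" and L: "L * Z = 1\<^sub>m k" and R: "W * R = 1\<^sub>m k"
    by (rule has_rankE[where n = n and m = n]) (use X Y in auto)
  have sum: "X * Y + Z * W = 1\<^sub>m n"
    unfolding E[symmetric] using X Y by (intro minus_add_dim) auto
  have "Y * (Z * W) = 0\<^sub>m s n"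
    unfolding E[symmetric] using X Y YX by (simp add: mat_dim cancel_left_dim)
  then have "Y * Z * W * R = 0\<^sub>m s k"
    using X Y c by (simp add: mat_dim)
  then have YZ: "Y * Z = 0\<^sub>m s k"
    using X Y c R by (simp add: mat_dim)
  have "Z * (W * X) = 0\<^sub>m n s"
  proof -
    have "Z * W * X = 0\<^sub>m n s"
      unfolding E[symmetric] using X Y YX by (simp add: mat_dim)
    then show ?thesis using X c by (simp add: mat_dim)
  qed
  then have "L * (Z * (W * X)) = 0\<^sub>m k s"
    using X c by (simp add: mat_dim)
  then have WX: "W * X = 0\<^sub>m k s"
    using X c L by (simp add: cancel_left_dim)
  have "L * ((X * Y + Z * W) * Z) = L * (1\<^sub>m n * Z)"
    by (simp add: sum)
  moreover have "L * ((X * Y + Z * W) * Z) = W * Z"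
    using X Y c L YZ by (simp add: mat_dim cancel_left_dim)
  ultimately have WZ: "W * Z = 1\<^sub>m k"
    using c L by (simp add: mat_dim)
  \<comment> \<open>The two products of the juxtaposed matrices are identities of sizes
    \<open>n\<close> and \<open>s + k\<close>; the two resulting inequalities determine
    \<open>k\<close>.\<close>
  have "append_cols X Z * (Y @\<^sub>r W) = 1\<^sub>m n"
    using sum X Y c by (subst append_cols_mult_append_rows) auto
  then have "n \<le> s + k"
    using one_mat_factor_le[of "append_cols X Z" n "s + k" "Y @\<^sub>r W"] X Y c by auto
  moreover have "(Y @\<^sub>r W) * append_cols X Z = four_block_mat (1\<^sub>m s) (0\<^sub>m s k) (0\<^sub>m k s) (1\<^sub>m k)"
    using X Y c YX YZ WX WZ by (subst append_rows_mult_append_cols) auto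
  then have "s + k \<le> n"
    using one_mat_factor_le[of "Y @\<^sub>r W" "s + k" n "append_cols X Z"] X Y c by auto
  ultimately have k: "k = n - s" "s \<le> n" by auto
  show thesis
    by (rule that[OF _ _ sum]) (use k c WZ YZ WX in auto)
qed

section \<open>Polynomials of matrices\<close>

definition mat_poly :: "'a :: field poly \<Rightarrow> 'a mat \<Rightarrow> 'a mat" where
  "mat_poly p A = fold_coeffs (\<lambda>a M. a \<cdot>\<^sub>m 1\<^sub>m (dim_row A) + A * M) p (0\<^sub>m (dim_row A) (dim_row A))"

lemma mat_poly_0 [simp]: "mat_poly 0 A = 0\<^sub>m (dim_row A) (dim_row A)"
  by (simp add: mat_poly_def)

lemma mat_poly_pCons:
  assumes "A \<in> carrier_mat n n"
  shows "mat_poly (pCons a p) A = a \<cdot>\<^sub>m 1\<^sub>m n + A * mat_poly p A"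
\<comment> \<open>\<open>fold_coeffs\<close> unfolds only at a nonzero \<open>pCons\<close>; at the
  zero polynomial the recursion is checked directly.\<close>
proof (cases "a = 0 \<and> p = 0")
  case True
  have "0 \<cdot>\<^sub>m 1\<^sub>m n + A * 0\<^sub>m n n = 0\<^sub>m n n"
    using assms by (intro eq_matI) auto
  then show ?thesis using True assms by simp
qed (use assms in \<open>auto simp: mat_poly_def\<close>)

lemma mat_poly_carrier [simp, intro]:
  assumes "A \<in> carrier_mat n n"
  shows "mat_poly p A \<in> carrier_mat n n"
  using assms by (induction p) (auto simp: mat_poly_pCons[OF assms])

lemma mat_poly_dim [simp]:
  assumes "dim_col A = dim_row A"
  shows "dim_row (mat_poly p A) = dim_row A" "dim_col (mat_poly p A) = dim_row A"
  using mat_poly_carrier[of A "dim_row A" p] assms by (metis carrier_matD carrier_matI)+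

lemma smult_mult_dim:
  fixes A :: "'a :: comm_semiring_0 mat"
  assumes "dim_col A = dim_row B"
  shows "A * (c \<cdot>\<^sub>m B) = c \<cdot>\<^sub>m (A * B)" "(c \<cdot>\<^sub>m A) * B = c \<cdot>\<^sub>m (A * B)"
  using assms by auto

lemma add_four_mat:
  fixes A :: "'a :: comm_monoid_add mat"
  assumes "dim_row A = n" "dim_row B = n" "dim_row C = n" "dim_row D = n"
    "dim_col A = m" "dim_col B = m" "dim_col C = m" "dim_col D = m"
  shows "(A + B) + (C + D) = (A + C) + (B + D)"
  using assms by (intro eq_matI) (auto simp: ac_simps)

lemma mat_poly_add:
  assumes "A \<in> carrier_mat n n"
  shows "mat_poly (p + q) A = mat_poly p A + mat_poly q A"
proof (induction p q rule: poly_induct2)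
  case (pCons a p b q)
  have "mat_poly (pCons a p + pCons b q) A =
      (a + b) \<cdot>\<^sub>m 1\<^sub>m n + A * (mat_poly p A + mat_poly q A)"
    using assms by (simp add: mat_poly_pCons pCons)
  also have "\<dots> = (a \<cdot>\<^sub>m 1\<^sub>m n + b \<cdot>\<^sub>m 1\<^sub>m n) + (A * mat_poly p A + A * mat_poly q A)"
    using assms by (simp add: mat_dim add_smult_distrib_right_mat[of _ n n])
  also have "\<dots> = mat_poly (pCons a p) A + mat_poly (pCons b q) A"
    unfolding mat_poly_pCons[OF assms] using assms by (intro add_four_mat[of _ n _ _ _ n]) auto
  finally show ?case .
qed (use assms in auto)

lemma mat_poly_smult:
  assumes "A \<in> carrier_mat n n"
  shows "mat_poly (Polynomial.smult c p) A = c \<cdot>\<^sub>m mat_poly p A"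
proof (induction p)
  case (pCons a p)
  have "mat_poly (Polynomial.smult c (pCons a p)) A = (c * a) \<cdot>\<^sub>m 1\<^sub>m n + A * (c \<cdot>\<^sub>m mat_poly p A)"
    using assms by (simp add: mat_poly_pCons pCons)
  also have "\<dots> = c \<cdot>\<^sub>m (a \<cdot>\<^sub>m 1\<^sub>m n + A * mat_poly p A)"
    using assms by (intro eq_matI) (auto simp: smult_mult_dim algebra_simps)
  finally show ?case using assms by (simp add: mat_poly_pCons)
qed (use assms in auto)

lemma mat_poly_mult:
  assumes "A \<in> carrier_mat n n"
  shows "mat_poly (p * q) A = mat_poly p A * mat_poly q A"
proof (induction p)
  case (pCons a p)
  have "mat_poly (pCons a p * q) A = mat_poly (Polynomial.smult a q + pCons 0 (p * q)) A"
    by simp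
  also have "\<dots> = a \<cdot>\<^sub>m mat_poly q A + (0 \<cdot>\<^sub>m 1\<^sub>m n + A * (mat_poly p A * mat_poly q A))"
    using assms by (simp only: mat_poly_add mat_poly_smult mat_poly_pCons pCons)
  also have "0 \<cdot>\<^sub>m 1\<^sub>m n + A * (mat_poly p A * mat_poly q A) = A * (mat_poly p A * mat_poly q A)"
    using assms by (intro eq_matI) auto
  also have "a \<cdot>\<^sub>m mat_poly q A + A * (mat_poly p A * mat_poly q A) = mat_poly (pCons a p) A * mat_poly q A"
    using assms by (simp add: mat_poly_pCons mat_dim smult_mult_dim)
  finally show ?case .
qed (use assms in \<open>auto simp: mat_dim\<close>)

lemma mat_poly_const:
  assumes "A \<in> carrier_mat n n"
  shows "mat_poly [:c:] A = c \<cdot>\<^sub>m 1\<^sub>m n"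
  using assms by (simp add: mat_poly_pCons mat_dim)

lemma mat_poly_1:
  assumes "A \<in> carrier_mat n n"
  shows "mat_poly 1 A = 1\<^sub>m n"
  using mat_poly_const[OF assms, of 1] by (simp add: one_pCons) (intro eq_matI, auto)

lemma mat_poly_X:
  assumes "A \<in> carrier_mat n n"
  shows "mat_poly [:0, 1:] A = A"
proof -
  have "0 \<cdot>\<^sub>m 1\<^sub>m n + A * (1 \<cdot>\<^sub>m 1\<^sub>m n) = A"
    using assms by (intro eq_matI) (auto simp: smult_mult_dim)
  then show ?thesis
    using assms by (simp add: mat_poly_pCons[of A n 0] mat_poly_const)
qed

lemma mat_poly_X_pow:
  assumes "A \<in> carrier_mat n n"
  shows "mat_poly ([:0, 1:] ^ k) A = A ^\<^sub>m k"
proof (induction k)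
  case (Suc k)
  have "mat_poly ([:0, 1:] ^ Suc k) A = mat_poly ([:0, 1:] ^ k * [:0, 1:]) A"
    by (simp add: mult.commute)
  then show ?case using Suc by (simp only: mat_poly_mult[OF assms] mat_poly_X[OF assms] pow_mat.simps)
qed (use assms in \<open>simp add: mat_poly_1\<close>)

text \<open>\<open>T\<close> may be rectangular: besides similarities this covers the inclusion of
  an invariant complement, and with \<open>T = A\<close> the commutation of \<open>A\<close> with
  its own polynomials.\<close>

lemma mat_poly_intertwine:
  assumes "A \<in> carrier_mat n n" "B \<in> carrier_mat m m" "T \<in> carrier_mat n m" "A * T = T * B"
  shows "mat_poly p A * T = T * mat_poly p B"
proof (induction p)
  case (pCons a p)
  have "A * (T * mat_poly p B) = A * T * mat_poly p B"
    using assms(1-3) by (simp add: mat_dim)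
  also have "\<dots> = T * (B * mat_poly p B)"
    using assms(1-3) unfolding assms(4) by (simp add: mat_dim)
  finally show ?case
    using assms(1-3) pCons by (simp add: mat_poly_pCons mat_dim smult_mult_dim)
qed (use assms in \<open>auto simp: mat_dim\<close>)

lemma mat_poly_four_block:
  assumes A: "A \<in> carrier_mat n n" and B: "B \<in> carrier_mat m m"
  shows "mat_poly p (four_block_mat A (0\<^sub>m n m) (0\<^sub>m m n) B) =
    four_block_mat (mat_poly p A) (0\<^sub>m n m) (0\<^sub>m m n) (mat_poly p B)"
proof (induction p)
  case 0
  show ?case using A B by auto
next
  case (pCons a p)
  have c: "four_block_mat A (0\<^sub>m n m) (0\<^sub>m m n) B \<in> carrier_mat (n + m) (n + m)"
    using A B by simp
  have "four_block_mat A (0\<^sub>m n m) (0\<^sub>m m n) B * four_block_mat (mat_poly p A) (0\<^sub>m n m) (0\<^sub>m m n) (mat_poly p B)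
     = four_block_mat (A * mat_poly p A) (0\<^sub>m n m) (0\<^sub>m m n) (B * mat_poly p B)"
    using A B by (subst mult_four_block_mat[of _ n n _ m _ m]) (auto simp: mat_dim)
  then show ?case
    unfolding mat_poly_pCons[OF c] mat_poly_pCons[OF A] mat_poly_pCons[OF B] pCons.IH
    using A B by (intro eq_matI) auto
qed

section \<open>Ranks of polynomials of companion matrices\<close>

definition poly_functional :: "('a :: field poly \<Rightarrow> 'a) \<Rightarrow> bool" where
  "poly_functional \<phi> \<longleftrightarrow> (\<forall>f g. \<phi> (f + g) = \<phi> f + \<phi> g) \<and> (\<forall>a f. \<phi> (Polynomial.smult a f) = a * \<phi> f)"

text \<open>Unlike \<open>degree f < d\<close>, this holds of the zero polynomial for every
  \<open>d\<close>, including 0, so it describes the span of the first \<open>d\<close> monomials in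
  all cases.\<close>

definition deg_lt :: "nat \<Rightarrow> 'a :: zero poly \<Rightarrow> bool" where
  "deg_lt d f \<longleftrightarrow> (\<forall>i\<ge>d. coeff f i = 0)"

definition functional_mat :: "nat \<Rightarrow> nat \<Rightarrow> (nat \<Rightarrow> 'a :: field poly \<Rightarrow> 'a) \<Rightarrow> 'a mat" where
  "functional_mat r c \<Phi> = mat r c (\<lambda>(i, j). \<Phi> i (monom 1 j))"

text \<open>The matrix of a linear map from polynomials of degree less than \<^term>\<open>c\<close> to polynomials of
  degree less than \<^term>\<open>r\<close>, with respect to the monomials.\<close>

definition poly_map_mat :: "nat \<Rightarrow> nat \<Rightarrow> ('a :: field poly \<Rightarrow> 'a poly) \<Rightarrow> 'a mat" where
  "poly_map_mat r c F = functional_mat r c (\<lambda>i f. coeff (F f) i)"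

lemma poly_functional_expand:
  assumes "poly_functional \<phi>" "deg_lt d f"
  shows "\<phi> f = (\<Sum>j = 0..<d. coeff f j * \<phi> (monom 1 j))"
proof -
  have add: "\<phi> (f + g) = \<phi> f + \<phi> g" and hom: "\<phi> (Polynomial.smult a f) = a * \<phi> f" for f g a
    using assms(1) by (auto simp: poly_functional_def)
  have zero: "\<phi> 0 = 0" using hom[of 0 0] by simp
  have "f = (\<Sum>j = 0..<d. Polynomial.smult (coeff f j) (monom 1 j))"
    using assms(2) by (intro poly_eqI) (auto simp: coeff_sum deg_lt_def if_distrib sum.delta cong: if_cong)
  also have "\<phi> \<dots> = (\<Sum>j = 0..<d. coeff f j * \<phi> (monom 1 j))"
    by (induction d) (auto simp: zero add hom simp del: smult_monom)
  finally show ?thesis .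
qed

lemma functional_mat_carrier [simp, intro]:
  "functional_mat r c \<Phi> \<in> carrier_mat r c" "poly_map_mat r c F \<in> carrier_mat r c"
  by (auto simp: functional_mat_def poly_map_mat_def)

lemma functional_mat_dim [simp]:
  "dim_row (functional_mat r c \<Phi>) = r" "dim_col (functional_mat r c \<Phi>) = c"
  "dim_row (poly_map_mat r c F) = r" "dim_col (poly_map_mat r c F) = c"
  by (auto simp: functional_mat_def poly_map_mat_def)

lemma poly_map_mat_cong:
  assumes "\<And>j. j < c \<Longrightarrow> F (monom 1 j) = G (monom 1 j)"
  shows "poly_map_mat r c F = poly_map_mat r c G"
  using assms by (auto simp: functional_mat_def poly_map_mat_def)

lemma poly_map_mat_id [simp]: "poly_map_mat r r (\<lambda>f. f) = 1\<^sub>m r"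
  by (intro eq_matI) (auto simp: functional_mat_def poly_map_mat_def)

lemma functional_mat_mult:
  assumes "\<And>i. i < r \<Longrightarrow> poly_functional (\<Phi> i)" "\<And>j. j < c \<Longrightarrow> deg_lt k (G (monom 1 j))"
  shows "functional_mat r k \<Phi> * poly_map_mat k c G = functional_mat r c (\<lambda>i f. \<Phi> i (G f))"
  using assms
  by (intro eq_matI)
    (auto simp: functional_mat_def poly_map_mat_def scalar_prod_def poly_functional_expand[of _ k] mult.commute)

lemma poly_map_mat_mult:
  assumes "\<And>f g. F (f + g) = F f + F g" "\<And>a f. F (Polynomial.smult a f) = Polynomial.smult a (F f)"
    "\<And>j. j < c \<Longrightarrow> deg_lt k (G (monom 1 j))"
  shows "poly_map_mat r k F * poly_map_mat k c G = poly_map_mat r c (\<lambda>f. F (G f))"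
  unfolding poly_map_mat_def[of r]
  by (rule functional_mat_mult) (auto simp: poly_functional_def assms)

lemma deg_ltI: "degree f < d \<Longrightarrow> deg_lt d f"
  by (auto simp: deg_lt_def coeff_eq_0)

lemma deg_lt_0 [simp]: "deg_lt d 0"
  by (simp add: deg_lt_def)

lemma deg_lt_monom [simp]: "j < d \<Longrightarrow> deg_lt d (monom 1 j)"
  by (auto simp: deg_lt_def)

lemma deg_lt_mono: "deg_lt k f \<Longrightarrow> k \<le> d \<Longrightarrow> deg_lt d f"
  by (auto simp: deg_lt_def)

lemma deg_lt_mod:
  fixes P :: "'a :: field poly"
  shows "P \<noteq> 0 \<Longrightarrow> deg_lt (degree P) (f mod P)"
  using degree_mod_less'[of P f] by (cases "f mod P = 0") (auto intro: deg_ltI)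

lemma monom_mod:
  fixes P :: "'a :: field poly"
  shows "j < degree P \<Longrightarrow> monom 1 j mod P = monom 1 j"
  by (intro mod_poly_less) (simp add: degree_monom_eq)

text \<open>Only the last column requires a reduction: for monic \<open>P\<close> of degree d, the
  remainder of X^d modulo \<open>P\<close> is X^d - P. Ranks of polynomials in
  \<open>companion_mat P\<close> thereby become questions about multiplication modulo
  \<open>P\<close>.\<close>

lemma companion_mat_eq:
  assumes "lead_coeff P = 1"
  shows "companion_mat P = poly_map_mat (degree P) (degree P) (\<lambda>f. ([:0, 1:] * f) mod P)"
proof (rule eq_matI, goal_cases)
  case (1 i j)
  then have ij: "i < degree P" "j < degree P"
    by (auto simp: poly_map_mat_def functional_mat_def)
  have X: "[:0, 1:] * monom 1 j = (monom 1 (Suc j) :: 'a poly)"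
    by (simp add: monom_Suc)
  show ?case
  proof (cases "Suc j = degree P")
    case True
    have "monom 1 (Suc j) - P = (monom 1 (Suc j) :: 'a poly) mod P"
    proof -
      have lt: "degree (monom 1 (Suc j) - P) < degree P"
      proof (rule degree_lessI)
        show "monom 1 (Suc j) - P \<noteq> 0 \<or> 0 < degree P" using ij by auto
        show "\<forall>k\<ge>degree P. coeff (monom 1 (Suc j) - P) k = 0"
          using True assms by (auto simp: coeff_eq_0 le_less)
      qed
      have "(monom 1 (Suc j) :: 'a poly) mod P = (monom 1 (Suc j) - P) mod P"
        by (metis diff_zero mod_diff_right_eq mod_self)
      then show ?thesis by (simp only: mod_poly_less[OF lt])
    qed
    then have "coeff (([:0, 1:] * monom 1 j) mod P) i = - coeff P i"
      unfolding X using True ij by (metis coeff_diff coeff_monom diff_0 less_irrefl)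
    then show ?thesis
      using ij True by (auto simp: companion_mat_def poly_map_mat_def functional_mat_def)
  next
    case False
    with ij show ?thesis
      by (auto simp: companion_mat_def poly_map_mat_def functional_mat_def X monom_mod[of "Suc j"] simp del: mult_pCons_left)
  qed
qed (auto simp: companion_mat_def)

lemma companion_mat_carrier [simp, intro]: "companion_mat P \<in> carrier_mat (degree P) (degree P)"
  by (simp add: companion_mat_def)

lemma mat_poly_companion_mat:
  assumes "lead_coeff P = 1"
  shows "mat_poly Q (companion_mat P) = poly_map_mat (degree P) (degree P) (\<lambda>f. (Q * f) mod P)"
proof (induction Q)
  case 0
  show ?case by (auto simp: poly_map_mat_def functional_mat_def companion_mat_def)
next
  case (pCons a q)
  let ?d = "degree P"
  have "P \<noteq> 0" using assms by auto
  have "companion_mat P * mat_poly q (companion_mat P) =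
      poly_map_mat ?d ?d (\<lambda>f. ([:0, 1:] * ((q * f) mod P)) mod P)"
    unfolding pCons unfolding companion_mat_eq[OF assms]
    by (rule poly_map_mat_mult)
      (simp_all only: distrib_left poly_mod_add_left mult_smult_right mod_smult_left deg_lt_mod[OF \<open>P \<noteq> 0\<close>])
  also have "a \<cdot>\<^sub>m 1\<^sub>m ?d + \<dots> = poly_map_mat ?d ?d (\<lambda>f. (pCons a q * f) mod P)"
  proof (rule eq_matI, goal_cases)
    case (1 i j)
    then have ij: "i < ?d" "j < ?d" by auto
    have "(pCons a q * monom 1 j) mod P = (Polynomial.smult a (monom 1 j) + [:0, 1:] * (q * monom 1 j)) mod P"
      by simp
    also have "\<dots> = Polynomial.smult a (monom 1 j) + ([:0, 1:] * ((q * monom 1 j) mod P)) mod P"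
      by (simp only: poly_mod_add_left mod_smult_left monom_mod[OF ij(2)] mod_mult_right_eq)
    finally have "coeff ((pCons a q * monom 1 j) mod P) i =
        a * coeff (monom 1 j) i + coeff (([:0, 1:] * ((q * monom 1 j) mod P)) mod P) i"
      by simp
    then show ?case
      using ij by (auto simp: poly_map_mat_def functional_mat_def simp del: mult_pCons_left)
  qed auto
  finally show ?case
    by (subst mat_poly_pCons[OF companion_mat_carrier])
qed

text \<open>\<open>D\<close> is a nonzero element of least degree in the ideal generated by
  \<open>P\<close> and \<open>Q\<close>; since remainders modulo \<open>D\<close> stay in that
  ideal, they vanish.\<close>

lemma poly_bezout:
  fixes P :: "'a :: field poly"
  assumes "P \<noteq> 0"
  obtains D u v where "D dvd P" "D dvd Q" "D = u * P + v * Q"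
proof -
  define I where "I = {D. D \<noteq> 0 \<and> (\<exists>u v. D = u * P + v * Q)}"
  have "P = 1 * P + 0 * Q" by simp
  then have "P \<in> I" using assms unfolding I_def by blast
  then obtain D where D: "D \<in> I" and min: "\<And>E. E \<in> I \<Longrightarrow> degree D \<le> degree E"
    using ex_has_least_nat[of "\<lambda>D. D \<in> I" P degree] by blast
  then obtain u v where uv: "D = u * P + v * Q" "D \<noteq> 0" unfolding I_def by blast
  have dvd: "D dvd E" if "E = s * P + t * Q" for E s t
  proof (rule ccontr)
    assume "\<not> D dvd E"
    then have nz: "E mod D \<noteq> 0" by (simp add: mod_eq_0_iff_dvd)
    have "E mod D = (s - E div D * u) * P + (t - E div D * v) * Q"
      using that uv(1) by (simp add: minus_div_mult_eq_mod[symmetric] algebra_simps)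
    with nz have "E mod D \<in> I" unfolding I_def by blast
    with min degree_mod_less'[OF \<open>D \<noteq> 0\<close> nz] show False by fastforce
  qed
  show thesis
    by (rule that[OF dvd[of P 1 0] dvd[of Q 0 1] uv(1)]) auto
qed

text \<open>With \<^term>\<open>P = D * P'\<close> and \<^term>\<open>Q = D * Q'\<close>, multiplication by \<^term>\<open>Q\<close> modulo \<^term>\<open>P\<close>
  is multiplication by \<^term>\<open>Q'\<close> modulo \<^term>\<open>P'\<close>, which is surjective, followed by multiplication
  by \<^term>\<open>D\<close>, which is injective.\<close>

lemma has_rank_mat_poly_companion_mat:
  fixes P Q :: "'a :: field poly"
  assumes P: "lead_coeff P = 1" and D: "D dvd P" "D dvd Q" "D = u * P + v * Q"
  shows "has_rank (mat_poly Q (companion_mat P)) (degree P - degree D)"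
proof -
  obtain P' Q' where PQ: "P = D * P'" "Q = D * Q'" using D(1,2) by (auto elim!: dvdE)
  have nz: "P \<noteq> 0" "D \<noteq> 0" "P' \<noteq> 0" using P PQ by auto
  let ?d = "degree P" and ?k = "degree P'"
  have deg: "?d = degree D + ?k" using nz PQ(1) by (simp add: degree_mult_eq)
  have "D * 1 = D * (u * P' + v * Q')" using D(3) unfolding PQ by (simp add: algebra_simps)
  then have bez: "1 = u * P' + v * Q'" using nz by (metis mult_left_cancel)
  \<comment> \<open>By the identity \<open>bez\<close>, \<open>v\<close> is an inverse of
    \<open>Q'\<close> modulo \<open>P'\<close>, so multiplication by \<open>v\<close> is the right
    inverse of \<open>?Y\<close>; exact division by \<open>D\<close> is the left inverse of
    \<open>?X\<close>.\<close>
  let ?X = "poly_map_mat ?d ?k (\<lambda>g. D * g)" and ?Y = "poly_map_mat ?k ?d (\<lambda>f. (Q' * f) mod P')"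
  let ?L = "poly_map_mat ?k ?d (\<lambda>h. h div D)" and ?R = "poly_map_mat ?d ?k (\<lambda>g. (v * g) mod P')"
  have "mat_poly Q (companion_mat P) = poly_map_mat ?d ?d (\<lambda>f. D * ((Q' * f) mod P'))"
    unfolding mat_poly_companion_mat[OF P]
    by (simp add: PQ mult.assoc mod_mult_mult1)
  also have "\<dots> = ?X * ?Y"
    by (rule poly_map_mat_mult[symmetric]) (auto simp: algebra_simps deg_lt_mod nz)
  finally have 1: "mat_poly Q (companion_mat P) = ?X * ?Y" .
  have "?L * ?X = poly_map_mat ?k ?k (\<lambda>g. (D * g) div D)"
    by (rule poly_map_mat_mult)
      (use nz deg in \<open>auto simp: poly_div_add_left div_smult_left degree_mult_eq degree_monom_eq intro!: deg_ltI\<close>)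
  then have 2: "?L * ?X = 1\<^sub>m ?k"
    using nz by simp
  have "?Y * ?R = poly_map_mat ?k ?k (\<lambda>g. (Q' * ((v * g) mod P')) mod P')"
    by (rule poly_map_mat_mult)
      (use nz deg in \<open>auto simp: poly_mod_add_left mod_smult_left algebra_simps intro: deg_lt_mono[OF deg_lt_mod]\<close>)
  also have "\<dots> = poly_map_mat ?k ?k (\<lambda>g. g)"
  proof (rule poly_map_mat_cong)
    fix j assume j: "j < ?k"
    have "Q' * (v * monom 1 j) = monom 1 j * (u * P' + v * Q') - u * monom 1 j * P'"
      by (simp add: algebra_simps)
    then have "(Q' * (v * monom 1 j)) mod P' = (monom 1 j - u * monom 1 j * P') mod P'"
      unfolding bez[symmetric] by simp
    also have "\<dots> = monom 1 j mod P'"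
      by (metis diff_zero mod_diff_right_eq mod_mult_self2_is_0)
    finally show "(Q' * ((v * monom 1 j) mod P')) mod P' = monom 1 j"
      using j by (simp add: mod_mult_right_eq monom_mod)
  qed
  finally have 3: "?Y * ?R = 1\<^sub>m ?k" by simp
  have c: "mat_poly Q (companion_mat P) \<in> carrier_mat ?d ?d" by simp
  then have "has_rank (mat_poly Q (companion_mat P)) ?k"
    unfolding has_rank_def carrier_matD[OF c] using 1 2 3 functional_mat_carrier(2) by blast
  then show ?thesis using deg by simp
qed

section \<open>Uniqueness of the invariant factors\<close>

lemma has_rank_four_block:
  assumes "has_rank A r" "has_rank B s" "A \<in> carrier_mat n n" "B \<in> carrier_mat m m"
  shows "has_rank (four_block_mat A (0\<^sub>m n m) (0\<^sub>m m n) B) (r + s)"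
proof -
  obtain X Y L R where c1: "X \<in> carrier_mat n r" "Y \<in> carrier_mat r n"
    "L \<in> carrier_mat r n" "R \<in> carrier_mat n r" and e1: "A = X * Y" "L * X = 1\<^sub>m r" "Y * R = 1\<^sub>m r"
    using has_rankE[OF assms(1,3)] by metis
  obtain X' Y' L' R' where c2: "X' \<in> carrier_mat m s" "Y' \<in> carrier_mat s m"
    "L' \<in> carrier_mat s m" "R' \<in> carrier_mat m s" and e2: "B = X' * Y'" "L' * X' = 1\<^sub>m s" "Y' * R' = 1\<^sub>m s"
    using has_rankE[OF assms(2,4)] by metis
  let ?X = "four_block_mat X (0\<^sub>m n s) (0\<^sub>m m r) X'" and ?Y = "four_block_mat Y (0\<^sub>m r m) (0\<^sub>m s n) Y'"
  let ?L = "four_block_mat L (0\<^sub>m r m) (0\<^sub>m s n) L'" and ?R = "four_block_mat R (0\<^sub>m n s) (0\<^sub>m m r) R'"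
  let ?M = "four_block_mat A (0\<^sub>m n m) (0\<^sub>m m n) B"
  have M: "?M \<in> carrier_mat (n + m) (n + m)" using assms by simp
  have "?X * ?Y = ?M"
    using c1 c2 by (subst mult_four_block_mat[of _ n r _ s _ m _ _ n _ m]) (auto simp: mat_dim e1(1) e2(1))
  moreover have "?L * ?X = 1\<^sub>m (r + s)"
    using c1 c2 by (subst mult_four_block_mat[of _ r n _ m _ s _ _ r _ s]) (auto simp: mat_dim e1(2) e2(2))
  moreover have "?Y * ?R = 1\<^sub>m (r + s)"
    using c1 c2 by (subst mult_four_block_mat[of _ r n _ m _ s _ _ r _ s]) (auto simp: mat_dim e1(3) e2(3))
  moreover have "?X \<in> carrier_mat (n + m) (r + s)" "?Y \<in> carrier_mat (r + s) (n + m)"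
    "?L \<in> carrier_mat (r + s) (n + m)" "?R \<in> carrier_mat (n + m) (r + s)"
    using c1 c2 by auto
  ultimately show ?thesis
    unfolding has_rank_def carrier_matD[OF M] by metis
qed

lemma similar_matE:
  assumes "similar_mat A B" "A \<in> carrier_mat n n"
  obtains S T where "S \<in> carrier_mat n n" "T \<in> carrier_mat n n" "B \<in> carrier_mat n n"
    "S * T = 1\<^sub>m n" "T * S = 1\<^sub>m n" "A = S * B * T"
proof -
  obtain m S T where "{A, B, S, T} \<subseteq> carrier_mat m m" "S * T = 1\<^sub>m m" "T * S = 1\<^sub>m m" "A = S * B * T"
    using similar_matD[OF assms(1)] by metis
  moreover from this have "m = n" using assms(2) by auto
  ultimately show thesis using that by auto
qed

lemma similar_mat_poly:
  assumes "similar_mat A B" "A \<in> carrier_mat n n"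
  shows "similar_mat (mat_poly Q A) (mat_poly Q B)"
proof -
  obtain S T where ST: "S \<in> carrier_mat n n" "T \<in> carrier_mat n n" and B: "B \<in> carrier_mat n n"
    and inv: "S * T = 1\<^sub>m n" "T * S = 1\<^sub>m n" and A: "A = S * B * T"
    using similar_matE[OF assms] by metis
  have "A * S = S * B"
    unfolding A using ST B inv by (simp add: mat_dim)
  then have *: "mat_poly Q A * S = S * mat_poly Q B"
    using mat_poly_intertwine[OF assms(2) B ST(1)] by simp
  have "mat_poly Q A = mat_poly Q A * S * T"
    using assms(2) ST B inv by (simp add: mat_dim)
  then have "mat_poly Q A = S * mat_poly Q B * T"
    unfolding * .
  then show ?thesis
    using assms(2) ST B inv by (intro similar_matI[of _ _ S T n]) auto
qed

lemma has_rank_similar: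
  assumes "similar_mat A B" "A \<in> carrier_mat n n" "has_rank B r"
  shows "has_rank A r"
proof -
  obtain S T where ST: "S \<in> carrier_mat n n" "T \<in> carrier_mat n n" and B: "B \<in> carrier_mat n n"
    and inv: "S * T = 1\<^sub>m n" "T * S = 1\<^sub>m n" and A: "A = S * B * T"
    using similar_matE[OF assms(1,2)] by metis
  obtain X Y L R where c: "X \<in> carrier_mat n r" "Y \<in> carrier_mat r n"
    "L \<in> carrier_mat r n" "R \<in> carrier_mat n r" and e: "B = X * Y" "L * X = 1\<^sub>m r" "Y * R = 1\<^sub>m r"
    using has_rankE[OF assms(3) B] by metis
  have "A = (S * X) * (Y * T)"
    unfolding A e(1) using ST c by (simp add: mat_dim)
  moreover have "(L * T) * (S * X) = 1\<^sub>m r" "(Y * T) * (S * R) = 1\<^sub>m r"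
    using ST c e inv by (simp_all add: mat_dim cancel_left_dim[OF inv(2)])
  moreover have "S * X \<in> carrier_mat n r" "Y * T \<in> carrier_mat r n" "L * T \<in> carrier_mat r n"
    "S * R \<in> carrier_mat n r"
    using ST c by auto
  ultimately show ?thesis
    unfolding has_rank_def carrier_matD[OF assms(2)] by metis
qed

text \<open>The class \<^class>\<open>field\<close> provides no polynomial gcd, hence the description by a Bezout identity.\<close>

definition gcd_degree :: "'a :: field poly \<Rightarrow> 'a poly \<Rightarrow> nat" where
  "gcd_degree P Q = (SOME k. \<exists>D u v. D dvd P \<and> D dvd Q \<and> D = u * P + v * Q \<and> k = degree D)"

lemma gcd_degreeE:
  fixes P :: "'a :: field poly"
  assumes "P \<noteq> 0"
  obtains D u v where "D dvd P" "D dvd Q" "D = u * P + v * Q" "gcd_degree P Q = degree D"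
proof -
  have "\<exists>k D u v. D dvd P \<and> D dvd Q \<and> D = u * P + v * Q \<and> k = degree D"
    using poly_bezout[OF assms] by metis
  from someI_ex[OF this] show thesis using that unfolding gcd_degree_def by blast
qed

lemma dvd_degree_eq_imp_dvd:
  fixes D :: "'a :: field poly"
  assumes "D dvd P" "degree D = degree P" "P \<noteq> 0"
  shows "P dvd D"
proof -
  from assms(1) obtain c where c: "P = D * c" by (elim dvdE)
  with assms have "degree c = 0" "c \<noteq> 0" by (auto simp: degree_mult_eq)
  then have "is_unit c" by (simp add: is_unit_iff_degree)
  then show ?thesis unfolding c by simp
qed

lemma gcd_degree_le:
  fixes P :: "'a :: field poly"
  assumes "P \<noteq> 0"
  shows "gcd_degree P Q \<le> degree P" "Q \<noteq> 0 \<Longrightarrow> gcd_degree P Q \<le> degree Q"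
  using gcd_degreeE[OF assms, of Q] assms by (metis dvd_imp_degree_le)+

text \<open>By the Bezout form every common divisor of \<open>P\<close> and \<open>Q\<close> divides
  \<open>D\<close>, so a gcd degree at either extreme amounts to a divisibility. This translates
  equalities of ranks back into statements about the factors.\<close>

lemma gcd_degree_eq:
  fixes P :: "'a :: field poly"
  assumes "P \<noteq> 0" "Q \<noteq> 0"
  shows "gcd_degree P Q = degree P \<longleftrightarrow> P dvd Q" "gcd_degree P Q = degree Q \<longleftrightarrow> Q dvd P"
proof -
  obtain D u v where D: "D dvd P" "D dvd Q" "D = u * P + v * Q" "gcd_degree P Q = degree D"
    using gcd_degreeE[OF assms(1)] by metis
  have nz: "D \<noteq> 0" using D(1) assms by auto
  show "gcd_degree P Q = degree P \<longleftrightarrow> P dvd Q"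
  proof
    assume "P dvd Q"
    then have "P dvd D" unfolding D(3) by simp
    then show "gcd_degree P Q = degree P"
      using D assms nz by (simp add: dvd_imp_degree_le le_antisym)
  qed (use D assms dvd_degree_eq_imp_dvd[of D P] dvd_trans in metis)
  show "gcd_degree P Q = degree Q \<longleftrightarrow> Q dvd P"
  proof
    assume "Q dvd P"
    then have "Q dvd D" unfolding D(3) by simp
    then show "gcd_degree P Q = degree Q"
      using D assms nz by (simp add: dvd_imp_degree_le le_antisym)
  qed (use D assms dvd_degree_eq_imp_dvd[of D Q] dvd_trans in metis)
qed

section \<open>The rank formula for invariant factors\<close>

abbreviation companion_diag :: "'a :: field poly list \<Rightarrow> 'a mat" where
  "companion_diag Ps \<equiv> diag_block_mat (map companion_mat Ps)"

lemma companion_diag_carrier [simp, intro]: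
  "companion_diag Ps \<in> carrier_mat (\<Sum>P\<leftarrow>Ps. degree P) (\<Sum>P\<leftarrow>Ps. degree P)"
  by (induction Ps) (auto simp: Let_def companion_mat_def)

lemma companion_diag_Cons:
  "companion_diag (P # Ps) = four_block_mat (companion_mat P) (0\<^sub>m (degree P) (\<Sum>P\<leftarrow>Ps. degree P))
     (0\<^sub>m (\<Sum>P\<leftarrow>Ps. degree P) (degree P)) (companion_diag Ps)"
  using carrier_matD[OF companion_diag_carrier[of Ps]] by (simp add: Let_def companion_mat_def)

lemma has_rank_mat_poly_companion_diag:
  assumes "\<And>P. P \<in> set Ps \<Longrightarrow> lead_coeff P = 1"
  shows "has_rank (mat_poly Q (companion_diag Ps)) (\<Sum>P\<leftarrow>Ps. degree P - gcd_degree P Q)"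
  using assms
proof (induction Ps)
  case Nil
  show ?case
    by (auto simp: has_rank_def intro!: exI[of _ "0\<^sub>m 0 0"])
next
  case (Cons P Ps)
  have P: "lead_coeff P = 1" using Cons.prems by simp
  then have "P \<noteq> 0" by auto
  then obtain D u v where "D dvd P" "D dvd Q" "D = u * P + v * Q" "gcd_degree P Q = degree D"
    using gcd_degreeE by metis
  then have "has_rank (mat_poly Q (companion_mat P)) (degree P - gcd_degree P Q)"
    using has_rank_mat_poly_companion_mat[OF P] by metis
  moreover have "has_rank (mat_poly Q (companion_diag Ps)) (\<Sum>P\<leftarrow>Ps. degree P - gcd_degree P Q)"
    using Cons by simp
  ultimately show ?case
    unfolding companion_diag_Cons mat_poly_four_block[OF companion_mat_carrier companion_diag_carrier]
    by (subst list.map, subst sum_list.Cons, intro has_rank_four_block) auto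
qed

context
  fixes A :: "'a :: field mat" and Ps :: "'a poly list"
  assumes A: "is_invariant_factors A Ps"
begin

lemma invariant_factors_monic: "i < length Ps \<Longrightarrow> lead_coeff (Ps ! i) = 1"
  using A by (auto simp: is_invariant_factors_def)

lemma invariant_factors_nz: "i < length Ps \<Longrightarrow> Ps ! i \<noteq> 0"
  using invariant_factors_monic by fastforce

lemma invariant_factors_dvd:
  assumes "i \<le> j" "j < length Ps"
  shows "Ps ! i dvd Ps ! j"
  using assms
proof (induction j rule: dec_induct)
  case (step j)
  then have "Ps ! j dvd Ps ! Suc j" using A by (auto simp: is_invariant_factors_def)
  with step show ?case by (auto intro: dvd_trans)
qed auto

lemma invariant_factors_square: "A \<in> carrier_mat (length Ps) (length Ps)"
  using A similar_matD[of A "companion_diag Ps"] by (auto simp: is_invariant_factors_def)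

lemma sum_degree_invariant_factors: "(\<Sum>j<length Ps. degree (Ps ! j)) = length Ps"
proof -
  have "similar_mat A (companion_diag Ps)" using A by (simp add: is_invariant_factors_def)
  then have "companion_diag Ps \<in> carrier_mat (length Ps) (length Ps)"
    using similar_matE[OF _ invariant_factors_square] by metis
  then have "(\<Sum>P\<leftarrow>Ps. degree P) = length Ps"
    using carrier_matD(1)[OF companion_diag_carrier[of Ps]] carrier_matD(1) by metis
  then show ?thesis by (simp add: sum_list_sum_nth atLeast0LessThan)
qed

lemma has_rank_mat_poly:
  "has_rank (mat_poly Q A) (length Ps - (\<Sum>j<length Ps. gcd_degree (Ps ! j) Q))"
proof -
  have "has_rank (mat_poly Q (companion_diag Ps)) (\<Sum>P\<leftarrow>Ps. degree P - gcd_degree P Q)"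
    using A by (intro has_rank_mat_poly_companion_diag) (auto simp: is_invariant_factors_def)
  also have "(\<Sum>P\<leftarrow>Ps. degree P - gcd_degree P Q) = (\<Sum>j<length Ps. degree (Ps ! j) - gcd_degree (Ps ! j) Q)"
    by (simp add: sum_list_sum_nth atLeast0LessThan)
  also have "\<dots> = length Ps - (\<Sum>j<length Ps. gcd_degree (Ps ! j) Q)"
    by (subst sum_subtractf_nat) (auto simp: sum_degree_invariant_factors gcd_degree_le invariant_factors_nz)
  finally show ?thesis
    using A similar_mat_poly[OF _ invariant_factors_square] has_rank_similar mat_poly_carrier invariant_factors_square
    unfolding is_invariant_factors_def by metis
qed

text \<open>Guards the truncated subtraction in \<open>has_rank_mat_poly\<close>: with this bound,
  equal ranks give equal sums of gcd degrees.\<close>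

lemma sum_gcd_degree_le: "(\<Sum>j<length Ps. gcd_degree (Ps ! j) Q) \<le> length Ps"
proof -
  have "(\<Sum>j<length Ps. gcd_degree (Ps ! j) Q) \<le> (\<Sum>j<length Ps. degree (Ps ! j))"
    by (intro sum_mono gcd_degree_le invariant_factors_nz) auto
  then show ?thesis by (simp add: sum_degree_invariant_factors)
qed

end

text \<open>The rank formula is tested at \<open>Ps ! i\<close>. Below \<open>i\<close> the terms of
  both lists agree by hypothesis; from \<open>i\<close> on the terms of \<open>Ps\<close> take the
  largest possible value, \<open>degree (Ps ! i)\<close>. So the terms of \<open>Qs\<close> are
  bounded by those of \<open>Ps\<close>, and equal sums force equality at \<open>i\<close>.\<close>

lemma invariant_factors_dvd_step:
  assumes P: "is_invariant_factors A Ps" and Q: "is_invariant_factors A Qs"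
    and i: "i < length Ps" and eq: "\<And>j. j < i \<Longrightarrow> Ps ! j = Qs ! j"
  shows "Ps ! i dvd Qs ! i"
proof -
  have len: "length Qs = length Ps" using P Q by (simp add: is_invariant_factors_def)
  let ?p = "\<lambda>j. gcd_degree (Ps ! j) (Ps ! i)" and ?q = "\<lambda>j. gcd_degree (Qs ! j) (Ps ! i)"
  have "length Ps - sum ?p {..<length Ps} = length Ps - sum ?q {..<length Ps}"
    using has_rank_unique[OF has_rank_mat_poly[OF P] has_rank_mat_poly[OF Q]] unfolding len .
  then have sums: "sum ?q {..<length Ps} = sum ?p {..<length Ps}"
    using sum_gcd_degree_le[OF P, of "Ps ! i"] sum_gcd_degree_le[OF Q, of "Ps ! i"] len by simp
  note nz = invariant_factors_nz[OF P] invariant_factors_nz[OF Q, unfolded len]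
  have "?q j \<le> ?p j" if "j < length Ps" for j
  proof (cases "j < i")
    case False
    then have "?p j = degree (Ps ! i)"
      using invariant_factors_dvd[OF P, of i j] that nz i by (simp add: gcd_degree_eq)
    then show ?thesis using gcd_degree_le(2) nz that i by metis
  qed (simp add: eq)
  then have "?q i = ?p i"
    using sum_mono_inv[OF sums] i by blast
  also have "\<dots> = degree (Ps ! i)" using nz i by (simp add: gcd_degree_eq)
  finally show ?thesis using nz i by (simp add: gcd_degree_eq)
qed

lemma monic_dvd_antisym:
  fixes P :: "'a :: field poly"
  assumes "P dvd Q" "Q dvd P" "lead_coeff P = 1" "lead_coeff Q = 1"
  shows "P = Q"
proof -
  from assms(1) obtain c where c: "Q = P * c" by (elim dvdE)
  have nz: "P \<noteq> 0" "Q \<noteq> 0" using assms by auto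
  then have "degree P = degree Q" using assms by (simp add: dvd_imp_degree_le le_antisym)
  then have "degree c = 0" using nz c by (auto simp: degree_mult_eq)
  moreover have "lead_coeff c = 1" using c assms by (simp add: lead_coeff_mult)
  ultimately have "c = 1" by (elim degree_eq_zeroE) (simp add: one_pCons)
  then show ?thesis using c by simp
qed

lemma invariant_factors_unique:
  assumes P: "is_invariant_factors A Ps" and Q: "is_invariant_factors A Qs"
  shows "Ps = Qs"
proof (rule nth_equalityI)
  show len: "length Ps = length Qs" using P Q by (simp add: is_invariant_factors_def)
  show "Ps ! i = Qs ! i" if "i < length Ps" for i
    using that
  proof (induction i rule: less_induct)
    case (less i)
    then have eq: "Ps ! j = Qs ! j" if "j < i" for j using that by simp
    show ?case
    proof (rule monic_dvd_antisym)
      show "Ps ! i dvd Qs ! i" "Qs ! i dvd Ps ! i"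
        using invariant_factors_dvd_step[OF P Q] invariant_factors_dvd_step[OF Q P] less.prems eq len by metis+
      show "lead_coeff (Ps ! i) = 1" "lead_coeff (Qs ! i) = 1"
        using invariant_factors_monic[OF P] invariant_factors_monic[OF Q] less.prems len by metis+
    qed
  qed
qed

lemma invariant_factors_eq: "is_invariant_factors A Ps \<Longrightarrow> invariant_factors A = Ps"
  unfolding invariant_factors_def using invariant_factors_unique by blast

section \<open>Existence of the invariant factors\<close>

definition act :: "'a :: field mat \<Rightarrow> 'a poly \<Rightarrow> 'a vec \<Rightarrow> 'a vec" where
  "act A f x = mat_poly f A *\<^sub>v x"

lemma dim_act [simp]: "dim_col A = dim_row A \<Longrightarrow> dim_vec (act A f x) = dim_row A"
  by (simp add: act_def)

text \<open>The columns are \<open>x\<close>, \<open>A x\<close>, ..., up to the power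
  \<open>d - 1\<close> of \<open>A\<close>. Written as the matrix of the linear map that sends
  \<open>f\<close> to \<open>act A f x\<close>, it accepts coefficient vectors of
  polynomials.\<close>

definition krylov :: "'a :: field mat \<Rightarrow> nat \<Rightarrow> 'a vec \<Rightarrow> 'a mat" where
  "krylov A d x = functional_mat (dim_row A) d (\<lambda>i f. act A f x $ i)"

lemma krylov_dim [simp]: "dim_row (krylov A d x) = dim_row A" "dim_col (krylov A d x) = d"
  by (simp_all add: krylov_def)

lemma smult_mat_mult_vec:
  fixes M :: "'a :: comm_ring mat"
  assumes "M \<in> carrier_mat n m" "x \<in> carrier_vec m"
  shows "(c \<cdot>\<^sub>m M) *\<^sub>v x = c \<cdot>\<^sub>v (M *\<^sub>v x)"
  using assms by (intro eq_vecI) (auto simp: scalar_prod_def sum_distrib_left mult.assoc)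

text \<open>For \<^term>\<open>d > 0\<close> this says that \<^term>\<open>\<phi>\<close> vanishes on \<^term>\<open>A ^\<^sub>m i *\<^sub>v x\<close> for
  \<^term>\<open>i < d - 1\<close> and is 1 on \<^term>\<open>A ^\<^sub>m (d - 1) *\<^sub>v x\<close>.\<close>

definition cyclic_pair :: "'a :: field mat \<Rightarrow> nat \<Rightarrow> 'a vec \<Rightarrow> 'a vec \<Rightarrow> bool" where
  "cyclic_pair A d x \<phi> \<longleftrightarrow> x \<in> carrier_vec (dim_row A) \<and> \<phi> \<in> carrier_vec (dim_row A) \<and>
     (\<forall>f. deg_lt d f \<longrightarrow> \<phi> \<bullet> act A f x = coeff f (d - 1))"

lemma mat_poly_transpose:
  assumes A: "A \<in> carrier_mat n n"
  shows "mat_poly f (transpose_mat A) = transpose_mat (mat_poly f A)"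
proof (induction f)
  case (pCons a f)
  have At: "transpose_mat A \<in> carrier_mat n n" using A by simp
  have comm: "A * mat_poly f A = mat_poly f A * A"
    using mat_poly_intertwine[OF A A A refl] by simp
  have "transpose_mat (mat_poly (pCons a f) A) = transpose_mat (a \<cdot>\<^sub>m 1\<^sub>m n) + transpose_mat (mat_poly f A * A)"
    unfolding mat_poly_pCons[OF A] comm using A by (intro transpose_add[of _ n n]) auto
  also have "\<dots> = a \<cdot>\<^sub>m 1\<^sub>m n + transpose_mat A * transpose_mat (mat_poly f A)"
    using A by (subst transpose_mult[of _ n n _ n]) auto
  finally show ?case unfolding mat_poly_pCons[OF At] pCons by simp
qed (use A in auto)

context
  fixes A :: "'a :: field mat" and n :: nat
  assumes A: "A \<in> carrier_mat n n"
begin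

lemma act_carrier [simp, intro]: "x \<in> carrier_vec n \<Longrightarrow> act A f x \<in> carrier_vec n"
  using A by (auto simp: act_def intro!: mult_mat_vec_carrier[of _ n n])

lemma act_add_poly: "x \<in> carrier_vec n \<Longrightarrow> act A (f + g) x = act A f x + act A g x"
  using A by (simp add: act_def mat_poly_add add_mult_distrib_mat_vec[of _ n n])

lemma act_smult_poly: "x \<in> carrier_vec n \<Longrightarrow> act A (Polynomial.smult c f) x = c \<cdot>\<^sub>v act A f x"
  using A by (simp add: act_def mat_poly_smult smult_mat_mult_vec[of _ n n])

lemma act_mult_poly: "x \<in> carrier_vec n \<Longrightarrow> act A (f * g) x = act A f (act A g x)"
  using A by (simp add: act_def mat_poly_mult[OF A] assoc_mult_mat_vec[of _ n n _ n])

lemma act_add_vec: "x \<in> carrier_vec n \<Longrightarrow> y \<in> carrier_vec n \<Longrightarrow> act A f (x + y) = act A f x + act A f y"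
  using A by (simp add: act_def mult_add_distrib_mat_vec[of _ n n])

lemma act_zero_vec: "act A f (0\<^sub>v n) = 0\<^sub>v n"
  using A by (auto simp: act_def)

lemma act_transpose:
  assumes "x \<in> carrier_vec n" "\<phi> \<in> carrier_vec n"
  shows "act (transpose_mat A) f \<phi> \<bullet> x = \<phi> \<bullet> act A f x"
  unfolding act_def mat_poly_transpose[OF A]
  using A assms by (intro transpose_vec_mult_scalar[of _ n n]) auto

lemma poly_functional_pairing:
  assumes "x \<in> carrier_vec n" "\<phi> \<in> carrier_vec n"
  shows "poly_functional (\<lambda>f. \<phi> \<bullet> act A f x)"
  using assms
  by (auto simp: poly_functional_def act_add_poly act_smult_poly
      scalar_prod_add_distrib[of _ n] scalar_prod_smult_distrib[of _ n])

lemma poly_functional_act_index: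
  assumes "x \<in> carrier_vec n" "i < n"
  shows "poly_functional (\<lambda>f. act A f x $ i)"
  using assms A by (simp add: poly_functional_def act_add_poly act_smult_poly)

lemma cyclic_pairD:
  assumes "cyclic_pair A d x \<phi>"
  shows "x \<in> carrier_vec n" "\<phi> \<in> carrier_vec n" "deg_lt d f \<Longrightarrow> \<phi> \<bullet> act A f x = coeff f (d - 1)"
  using assms A by (auto simp: cyclic_pair_def)

lemma cyclic_pairI:
  assumes "x \<in> carrier_vec n" "\<phi> \<in> carrier_vec n" "d > 0"
    "\<And>j. j < d \<Longrightarrow> \<phi> \<bullet> act A (monom 1 j) x = (if j = d - 1 then 1 else 0)"
  shows "cyclic_pair A d x \<phi>"
  unfolding cyclic_pair_def
proof (intro conjI allI impI)
  fix f :: "'a poly" assume f: "deg_lt d f"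
  have "\<phi> \<bullet> act A f x = (\<Sum>j = 0..<d. coeff f j * (if j = d - 1 then 1 else 0))"
    unfolding poly_functional_expand[OF poly_functional_pairing[OF assms(1,2)] f]
    by (intro sum.cong) (auto simp: assms(4))
  also have "\<dots> = coeff f (d - 1)"
    using assms(3) by (simp add: if_distrib cong: if_cong)
  finally show "\<phi> \<bullet> act A f x = coeff f (d - 1)" .
qed (use assms A in auto)

lemma krylov_carrier [simp, intro]: "krylov A d x \<in> carrier_mat n d"
  using A by (simp add: krylov_def)

lemma col_krylov:
  assumes "x \<in> carrier_vec n" "j < d"
  shows "col (krylov A d x) j = act A (monom 1 j) x"
  using assms A by (intro eq_vecI) (auto simp: krylov_def functional_mat_def)

lemma krylov_mult_vec:
  assumes "x \<in> carrier_vec n" "deg_lt d f"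
  shows "krylov A d x *\<^sub>v vec d (coeff f) = act A f x"
proof (rule eq_vecI)
  show "dim_vec (krylov A d x *\<^sub>v vec d (coeff f)) = dim_vec (act A f x)"
    using A by simp
  fix i assume "i < dim_vec (act A f x)"
  then have i: "i < n" using A by simp
  have "act A f x $ i = (\<Sum>j = 0..<d. coeff f j * act A (monom 1 j) x $ i)"
    by (rule poly_functional_expand[OF poly_functional_act_index[OF assms(1) i] assms(2)])
  then show "(krylov A d x *\<^sub>v vec d (coeff f)) $ i = act A f x $ i"
    using i A by (simp add: krylov_def functional_mat_def scalar_prod_def mult.commute)
qed

lemma act_mod:
  assumes x: "x \<in> carrier_vec n" and 0: "act A P x = 0\<^sub>v n"
  shows "act A f x = act A (f mod P) x"
proof -
  have "act A f x = act A (f div P * P + f mod P) x"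
    by simp
  also have "\<dots> = act A (f div P) (act A P x) + act A (f mod P) x"
    using x by (simp only: act_add_poly act_mult_poly)
  also have "\<dots> = act A (f mod P) x"
    using act_carrier[OF x, of "f mod P"] by (simp add: 0 act_zero_vec)
  finally show ?thesis .
qed

text \<open>Because \<open>P\<close> annihilates \<open>x\<close>, the map from \<open>f\<close> to
  \<open>act A f x\<close> depends only on \<open>f mod P\<close>, and it turns multiplication by
  the variable into \<open>A\<close>.\<close>

lemma krylov_companion_mat:
  assumes x: "x \<in> carrier_vec n" and P: "lead_coeff P = 1" and 0: "act A P x = 0\<^sub>v n"
  shows "A * krylov A (degree P) x = krylov A (degree P) x * companion_mat P"
proof (rule mat_col_eqI)
  let ?d = "degree P" and ?T = "krylov A (degree P) x"
  have nz: "P \<noteq> 0" using P by auto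
  show "dim_row (A * ?T) = dim_row (?T * companion_mat P)" "dim_col (A * ?T) = dim_col (?T * companion_mat P)"
    using A by (auto simp: companion_mat_def)
  fix j assume "j < dim_col (?T * companion_mat P)"
  then have j: "j < ?d" by (simp add: companion_mat_def)
  define f where "f = ([:0, 1:] :: 'a poly) * monom 1 j"
  have f: "act A f x = act A (f mod P) x" by (rule act_mod[OF x 0])
  have "col (A * ?T) j = A *\<^sub>v act A (monom 1 j) x"
    using A j x by (subst col_mult2[of _ n n _ ?d]) (auto simp: col_krylov)
  also have "\<dots> = act A f x"
    using x by (simp add: f_def act_mult_poly del: mult_pCons_left) (simp add: act_def mat_poly_X[OF A])
  also have "\<dots> = ?T *\<^sub>v vec ?d (coeff (f mod P))"
    unfolding f using x nz by (intro krylov_mult_vec[symmetric] deg_lt_mod)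
  also have "vec ?d (coeff (f mod P)) = col (companion_mat P) j"
    unfolding companion_mat_eq[OF P] f_def
    using j by (intro eq_vecI) (auto simp: poly_map_mat_def functional_mat_def)
  also have "?T *\<^sub>v col (companion_mat P) j = col (?T * companion_mat P) j"
    using j by (intro col_mult2[symmetric, of _ n ?d _ ?d]) auto
  finally show "col (A * ?T) j = col (?T * companion_mat P) j" .
qed

text \<open>The rows of the inner \<open>S\<close> are the forms \<open>\<phi>\<close> composed with
  powers of \<open>A\<close>, and its product with the Krylov matrix is triangular with ones on the
  diagonal. Multiplying by the inverse \<open>G\<close> of that product gives a left inverse without
  changing the kernel, which is the future complement.\<close>

lemma cyclic_pair_left_inverse:
  assumes cp: "cyclic_pair A d x \<phi>"
  obtains S where "S \<in> carrier_mat d n" "S * krylov A d x = 1\<^sub>m d"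
    "\<And>y. y \<in> carrier_vec n \<Longrightarrow> S *\<^sub>v y = 0\<^sub>v d \<longleftrightarrow> (\<forall>i<d. \<phi> \<bullet> act A (monom 1 i) y = 0)"
proof -
  note x = cyclic_pairD(1)[OF cp] and \<phi> = cyclic_pairD(2)[OF cp]
  \<comment> \<open>The exponents decrease with the row index, so that the pairing at
    \<open>(i, j)\<close> has exponent \<open>d - 1 - i + j\<close>: it is 1 on the diagonal and 0
    below it.\<close>
  define S where "S = mat d n (\<lambda>(i, k). act (transpose_mat A) (monom 1 (d - 1 - i)) \<phi> $ k)"
  have S: "S \<in> carrier_mat d n" by (simp add: S_def)
  have At: "transpose_mat A \<in> carrier_mat n n" using A by simp
  have row: "row S i = act (transpose_mat A) (monom 1 (d - 1 - i)) \<phi>" if "i < d" for i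
    using that A by (intro eq_vecI) (auto simp: S_def)
  have S_pair: "row S i \<bullet> y = \<phi> \<bullet> act A (monom 1 (d - 1 - i)) y" if "i < d" "y \<in> carrier_vec n" for i y
    using that \<phi> by (simp add: row act_transpose)
  define H where "H = S * krylov A d x"
  have H: "H \<in> carrier_mat d d" using S by (auto simp: H_def)
  have H_index: "H $$ (i, j) = \<phi> \<bullet> act A (monom 1 (d - 1 - i + j)) x" if "i < d" "j < d" for i j
  proof -
    have "H $$ (i, j) = row S i \<bullet> act A (monom 1 j) x"
      using that S A by (simp add: H_def col_krylov x)
    also have "\<dots> = \<phi> \<bullet> act A (monom 1 (d - 1 - i)) (act A (monom 1 j) x)"
      using that x by (simp add: S_pair)
    also have "\<dots> = \<phi> \<bullet> act A (monom 1 (d - 1 - i + j)) x"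
      using x by (simp add: act_mult_poly[symmetric] mult_monom)
    finally show ?thesis .
  qed
  have tri: "H $$ (i, j) = (if i = j then 1 else 0)" if "j \<le> i" "i < d" for i j
    using that by (auto simp: H_index cyclic_pairD(3)[OF cp])
  have "upper_triangular H" using H tri by (auto simp: upper_triangular_def)
  then have "det H = prod_list (diag_mat H)" using det_upper_triangular H by blast
  also have "\<dots> = 1" using H tri by (simp add: diag_mat_def flip: prod.distinct_set_conv_list)
  finally have "det H \<noteq> 0" by simp
  from det_non_zero_imp_unit[OF H this, of "()"] obtain G where
    G: "G \<in> carrier_mat d d" "G * H = 1\<^sub>m d" "H * G = 1\<^sub>m d"
    unfolding Units_def ring_mat_simps by auto
  show thesis
  proof (rule that)
    show "G * S \<in> carrier_mat d n" using G S by simp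
    show "G * S * krylov A d x = 1\<^sub>m d"
      using G S A by (simp add: mat_dim H_def)
    fix y :: "'a vec" assume y: "y \<in> carrier_vec n"
    have "S *\<^sub>v y = H *\<^sub>v (G *\<^sub>v (S *\<^sub>v y))"
      using G H S y by (simp flip: assoc_mult_mat_vec[of _ d d _ d])
    then have "G * S *\<^sub>v y = 0\<^sub>v d \<longleftrightarrow> S *\<^sub>v y = 0\<^sub>v d"
      using G H S y by (auto simp: assoc_mult_mat_vec[of _ d d _ n])
    also have "\<dots> \<longleftrightarrow> (\<forall>i<d. \<phi> \<bullet> act A (monom 1 (d - 1 - i)) y = 0)"
    proof
      assume 0: "S *\<^sub>v y = 0\<^sub>v d"
      show "\<forall>i<d. \<phi> \<bullet> act A (monom 1 (d - 1 - i)) y = 0"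
      proof (intro allI impI)
        fix i assume i: "i < d"
        have "(S *\<^sub>v y) $ i = \<phi> \<bullet> act A (monom 1 (d - 1 - i)) y"
          using i S y by (simp add: S_pair)
        then show "\<phi> \<bullet> act A (monom 1 (d - 1 - i)) y = 0" using 0 i by simp
      qed
    qed (use S y in \<open>auto intro!: eq_vecI simp: S_pair\<close>)
    also have "\<dots> \<longleftrightarrow> (\<forall>i<d. \<phi> \<bullet> act A (monom 1 i) y = 0)"
    proof (intro iffI allI impI)
      fix i assume *: "\<forall>i<d. \<phi> \<bullet> act A (monom 1 (d - 1 - i)) y = 0" "i < d"
      then have "\<phi> \<bullet> act A (monom 1 (d - 1 - (d - 1 - i))) y = 0"
        using *(1)[rule_format, of "d - 1 - i"] by simp
      moreover have "d - 1 - (d - 1 - i) = i" using *(2) by simp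
      ultimately show "\<phi> \<bullet> act A (monom 1 i) y = 0" by simp
    qed simp
    finally show "G * S *\<^sub>v y = 0\<^sub>v d \<longleftrightarrow> (\<forall>i<d. \<phi> \<bullet> act A (monom 1 i) y = 0)" .
  qed
qed

lemma cyclic_pair_le:
  assumes "cyclic_pair A d x \<phi>"
  shows "d \<le> n"
  using cyclic_pair_left_inverse[OF assms] one_mat_factor_le krylov_carrier by metis

text \<open>If \<^term>\<open>A ^\<^sub>m d *\<^sub>v x\<close> did not depend on the lower powers, some functional would
  vanish on them and not on it.\<close>

lemma cyclic_pair_annihilator:
  assumes cp: "cyclic_pair A d x \<phi>" and max: "\<And>\<psi>. \<not> cyclic_pair A (Suc d) x \<psi>"
  obtains P where "lead_coeff P = 1" "degree P = d" "act A P x = 0\<^sub>v n"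
proof -
  note x = cyclic_pairD(1)[OF cp]
  let ?T = "krylov A d x"
  obtain S where S: "S \<in> carrier_mat d n" and ST: "S * ?T = 1\<^sub>m d"
    using cyclic_pair_left_inverse[OF cp] by metis
  have T: "?T \<in> carrier_mat n d" by simp
  define v where "v = act A (monom 1 d) x"
  have v: "v \<in> carrier_vec n" using x by (simp add: v_def)
  \<comment> \<open>The projection \<open>E\<close> kills the columns of \<open>?T\<close>, so
    \<open>E *\<^sub>v v\<close> vanishes exactly when \<open>v\<close> depends on the lower powers;
    otherwise a scaled row of \<open>E\<close> would make \<open>x\<close> part of a pair of length
    \<open>Suc d\<close>.\<close>
  define E where "E = 1\<^sub>m n - ?T * S"
  have E: "E \<in> carrier_mat n n" using S T A by (auto simp: E_def)
  have Ev: "E *\<^sub>v v = v - ?T *\<^sub>v (S *\<^sub>v v)"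
    using v
    by (simp add: E_def minus_mult_distrib_mat_vec[OF one_carrier_mat mult_carrier_mat[OF T S] v]
        assoc_mult_mat_vec[OF T S v])
  have "E * ?T = 0\<^sub>m n d"
    using S T ST A by (simp add: E_def mat_dim)
  then have ET: "E *\<^sub>v act A (monom 1 j) x = 0\<^sub>v n" if "j < d" for j
    using col_mult2[OF E T that] that x by (simp add: col_krylov)
  have "E *\<^sub>v v = 0\<^sub>v n"
  proof (rule ccontr)
    assume "E *\<^sub>v v \<noteq> 0\<^sub>v n"
    then obtain i where i: "i < n" "(E *\<^sub>v v) $ i \<noteq> 0"
      using E by (metis dim_mult_mat_vec carrier_matD(1) eq_vecI index_zero_vec)
    define \<psi> where "\<psi> = inverse ((E *\<^sub>v v) $ i) \<cdot>\<^sub>v row E i"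
    have \<psi>: "\<psi> \<in> carrier_vec n" using E i by (auto simp: \<psi>_def)
    have pair: "\<psi> \<bullet> y = inverse ((E *\<^sub>v v) $ i) * (E *\<^sub>v y) $ i" if "y \<in> carrier_vec n" for y
      using that E i by (simp add: \<psi>_def smult_scalar_prod_distrib[of _ n])
    have "cyclic_pair A (Suc d) x \<psi>"
    proof (rule cyclic_pairI[OF x \<psi>])
      fix j assume j: "j < Suc d"
      show "\<psi> \<bullet> act A (monom 1 j) x = (if j = Suc d - 1 then 1 else 0)"
      proof (cases "j = d")
        case True
        then show ?thesis using pair[OF v] i by (simp add: v_def)
      next
        case False
        then show ?thesis using j i pair[OF act_carrier[OF x]] ET[of j] by simp
      qed
    qed simp
    with max show False by blast
  qed
  then have 0: "v - ?T *\<^sub>v (S *\<^sub>v v) = 0\<^sub>v n" unfolding Ev .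
  have v_eq: "v = ?T *\<^sub>v (S *\<^sub>v v)"
  proof (rule eq_vecI)
    fix i assume "i < dim_vec (?T *\<^sub>v (S *\<^sub>v v))"
    then have "i < n" using A by simp
    then show "v $ i = (?T *\<^sub>v (S *\<^sub>v v)) $ i"
      using arg_cong[OF 0, of "\<lambda>w. w $ i"] A by simp
  qed (use v A in simp)
  \<comment> \<open>Since \<open>v\<close> lies in the range of \<open>?T\<close>, these are its
    coordinates with respect to the lower powers; with reversed sign they become the lower
    coefficients of \<open>P\<close>.\<close>
  define c where "c = S *\<^sub>v v"
  have c: "c \<in> carrier_vec d" using S v by (simp add: c_def)
  define g where "g = (\<Sum>j<d. monom (c $ j) j)"
  have coeff_g: "coeff g i = (if i < d then c $ i else 0)" for i
    by (auto simp: g_def coeff_sum)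
  have g: "deg_lt d g" by (simp add: deg_lt_def coeff_g)
  have "vec d (coeff g) = c" using c by (intro eq_vecI) (auto simp: coeff_g)
  then have vg: "act A g x = v"
    using krylov_mult_vec[OF x g] v_eq by (simp add: c_def)
  define P where "P = monom 1 d + Polynomial.smult (- 1) g"
  have coeff_P: "coeff P d = 1" "\<And>i. i > d \<Longrightarrow> coeff P i = 0"
    by (auto simp: P_def coeff_g)
  then have deg: "degree P = d"
    by (metis coeff_0 degree_le le_antisym le_degree zero_neq_one)
  show thesis
  proof (rule that[OF _ deg])
    show "lead_coeff P = 1" using coeff_P deg by simp
    have "act A P x = v + (- 1) \<cdot>\<^sub>v v"
      unfolding P_def using x by (simp only: act_add_poly act_smult_poly vg v_def)
    then show "act A P x = 0\<^sub>v n" using v by (auto intro!: eq_vecI)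
  qed
qed

text \<open>Transposition moves a polynomial of \<open>A\<close> from one side of the pairing to the
  other. Hence the annihilator lemma also applies to \<open>\<phi>\<close>.\<close>

lemma cyclic_pair_transpose:
  assumes "cyclic_pair A d x \<phi>"
  shows "cyclic_pair (transpose_mat A) d \<phi> x"
proof -
  note x = cyclic_pairD(1)[OF assms] and \<phi> = cyclic_pairD(2)[OF assms]
  have At: "transpose_mat A \<in> carrier_mat n n" using A by simp
  have "act (transpose_mat A) f \<phi> \<in> carrier_vec n" for f
    unfolding act_def using At \<phi> by (auto intro!: mult_mat_vec_carrier[of _ n n])
  then have "x \<bullet> act (transpose_mat A) f \<phi> = \<phi> \<bullet> act A f x" for f
    using act_transpose[OF x \<phi>] comm_scalar_prod[OF x] by metis
  then show ?thesis using A x \<phi> cyclic_pairD(3)[OF assms] by (auto simp: cyclic_pair_def)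
qed

section \<open>Splitting off a maximal cyclic subspace\<close>

context
  fixes d :: nat and x \<phi> :: "'a vec" and R :: "'a poly"
  assumes cp: "cyclic_pair A d x \<phi>" and d: "d > 0"
    and max: "\<And>x \<phi>. \<not> cyclic_pair A (Suc d) x \<phi>"
    and R: "lead_coeff R = 1" "degree R = d" "act (transpose_mat A) R \<phi> = 0\<^sub>v n"
begin

text \<open>As \<open>R\<close> annihilates \<open>\<phi>\<close> under the transposed matrix, the
  pairing with \<open>act A f y\<close> depends only on \<open>f mod R\<close>, whose degree is
  below \<open>d\<close>. So the joint kernel of the first \<open>d\<close> forms is invariant under
  \<open>A\<close>.\<close>

lemma cyclic_pair_kernel:
  assumes y: "y \<in> carrier_vec n" and 0: "\<And>i. i < d \<Longrightarrow> \<phi> \<bullet> act A (monom 1 i) y = 0"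
  shows "\<phi> \<bullet> act A f y = 0"
proof -
  note \<phi> = cyclic_pairD(2)[OF cp]
  have "R \<noteq> 0" using R(1) by auto
  have "act A f y = act A (R * (f div R) + f mod R) y" by simp
  also have "\<dots> = act A R (act A (f div R) y) + act A (f mod R) y"
    using y by (simp only: act_add_poly act_mult_poly)
  finally have "\<phi> \<bullet> act A f y = \<phi> \<bullet> act A R (act A (f div R) y) + \<phi> \<bullet> act A (f mod R) y"
    using y \<phi> by (simp add: scalar_prod_add_distrib[of _ n])
  also have "\<phi> \<bullet> act A R (act A (f div R) y) = 0"
    unfolding act_transpose[OF act_carrier[OF y] \<phi>, symmetric] R(3) using y by simp
  also have "0 + \<phi> \<bullet> act A (f mod R) y = \<phi> \<bullet> act A (f mod R) y" by simp
  also have "\<dots> = 0"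
    using poly_functional_expand[OF poly_functional_pairing[OF y \<phi>] deg_lt_mod[OF \<open>R \<noteq> 0\<close>, of f]] R(2) 0
    by simp
  finally show ?thesis .
qed

text \<open>Adding a vector \<^term>\<open>y\<close> of the kernel to \<^term>\<open>x\<close> gives another cyclic pair,
  and its annihilator must also annihilate \<^term>\<open>x\<close>.\<close>

lemma cyclic_pair_annihilates_kernel:
  assumes P: "lead_coeff P = 1" "degree P = d" "act A P x = 0\<^sub>v n"
    and y: "y \<in> carrier_vec n" and 0: "\<And>i. i < d \<Longrightarrow> \<phi> \<bullet> act A (monom 1 i) y = 0"
  shows "act A P y = 0\<^sub>v n"
proof -
  note x = cyclic_pairD(1)[OF cp] and \<phi> = cyclic_pairD(2)[OF cp]
  have pair: "\<phi> \<bullet> act A f (x + y) = \<phi> \<bullet> act A f x" for f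
    using x y \<phi> cyclic_pair_kernel[OF y 0]
    by (simp add: act_add_vec scalar_prod_add_distrib[of _ n])
  have "cyclic_pair A d (x + y) \<phi>"
    using x y \<phi> A cyclic_pairD(3)[OF cp] by (auto simp: cyclic_pair_def pair)
  then obtain Q where Q: "lead_coeff Q = 1" "degree Q = d" "act A Q (x + y) = 0\<^sub>v n"
    using cyclic_pair_annihilator max by metis
  have xy: "x + y \<in> carrier_vec n" using x y by simp
  have Qx: "\<phi> \<bullet> act A (f * Q) x = 0" for f
  proof -
    have "\<phi> \<bullet> act A (f * Q) x = \<phi> \<bullet> act A (f * Q) (x + y)" by (simp add: pair)
    also have "act A (f * Q) (x + y) = 0\<^sub>v n" using xy by (simp add: act_mult_poly Q act_zero_vec)
    finally show ?thesis using \<phi> by simp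
  qed
  have Px: "\<phi> \<bullet> act A (f * P) x = 0" for f
    using x \<phi> by (simp add: act_mult_poly P act_zero_vec)
  define g where "g = Q - P"
  have "g = 0"
  proof (rule ccontr)
    assume "g \<noteq> 0"
    have "degree g < d"
    proof (rule degree_lessI)
      show "\<forall>k\<ge>d. coeff g k = 0"
        using P Q by (auto simp: g_def coeff_eq_0 le_less)
    qed (use d in simp)
    \<comment> \<open>\<open>f\<close> raises \<open>g\<close> to degree exactly
      \<open>d - 1\<close>, where the pair reads off the leading coefficient. As
      \<open>\<phi>\<close> vanishes on all multiples of \<open>Q\<close> and of \<open>P\<close>
      applied to \<open>x\<close>, that coefficient would have to be 0.\<close>
    define f where "f = monom (1 :: 'a) (d - 1 - degree g)"
    have "degree (f * g) < d"
      using \<open>g \<noteq> 0\<close> \<open>degree g < d\<close> by (simp add: f_def degree_mult_eq degree_monom_eq)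
    then have "\<phi> \<bullet> act A (f * g) x = coeff (f * g) (d - 1)"
      using cyclic_pairD(3)[OF cp] deg_ltI by blast
    also have "\<dots> = lead_coeff g"
      using \<open>degree g < d\<close> by (simp add: f_def coeff_monom_mult)
    finally have "\<phi> \<bullet> act A (f * g) x \<noteq> 0" using \<open>g \<noteq> 0\<close> by simp
    moreover have "f * Q = f * g + f * P" by (simp add: g_def algebra_simps)
    then have "\<phi> \<bullet> act A (f * Q) x = \<phi> \<bullet> act A (f * g) x + \<phi> \<bullet> act A (f * P) x"
      using x \<phi> by (simp add: act_add_poly scalar_prod_add_distrib[of _ n])
    ultimately show False by (simp add: Qx Px)
  qed
  then have "act A P x + act A P y = 0\<^sub>v n"
    using Q(3) x y by (simp add: g_def act_add_vec)
  then show ?thesis using P(3) y by simp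
qed

text \<open>In the basis formed by the columns of \<open>Z\<close>, spanning the kernel of
  \<open>S\<close>, and those of the Krylov matrix, \<open>A\<close> is block diagonal. The cyclic
  block stands last because \<open>P\<close> will be the largest invariant factor: it annihilates
  \<open>B\<close>, so the factors of \<open>B\<close> divide it.\<close>

lemma cyclic_decomposition_aux:
  obtains P B where "lead_coeff P = 1" "0 < degree P" "degree P \<le> n"
    "B \<in> carrier_mat (n - degree P) (n - degree P)"
    "similar_mat A (four_block_mat B (0\<^sub>m (n - degree P) (degree P)) (0\<^sub>m (degree P) (n - degree P)) (companion_mat P))"
    "mat_poly P B = 0\<^sub>m (n - degree P) (n - degree P)"
proof -
  note x = cyclic_pairD(1)[OF cp]
  let ?T = "krylov A d x" and ?m = "n - d"
  have T: "?T \<in> carrier_mat n d" by simp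
  obtain P where P: "lead_coeff P = 1" "degree P = d" "act A P x = 0\<^sub>v n"
    using cyclic_pair_annihilator[OF cp max] by metis
  obtain S where S: "S \<in> carrier_mat d n" "S * ?T = 1\<^sub>m d"
    and ker: "\<And>y. y \<in> carrier_vec n \<Longrightarrow> S *\<^sub>v y = 0\<^sub>v d \<longleftrightarrow> (\<forall>i<d. \<phi> \<bullet> act A (monom 1 i) y = 0)"
    using cyclic_pair_left_inverse[OF cp] by metis
  obtain Z W where ZW: "Z \<in> carrier_mat n ?m" "W \<in> carrier_mat ?m n" "?T * S + Z * W = 1\<^sub>m n"
    "W * Z = 1\<^sub>m ?m" "S * Z = 0\<^sub>m d ?m" "W * ?T = 0\<^sub>m ?m d" and dn: "d \<le> n"
    using right_inverse_completion[OF T S] by metis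
  have colZ: "col Z j \<in> carrier_vec n" "\<And>f. \<phi> \<bullet> act A f (col Z j) = 0" "act A P (col Z j) = 0\<^sub>v n"
    if j: "j < ?m" for j
  proof -
    show c: "col Z j \<in> carrier_vec n" using ZW(1) j by auto
    have "S *\<^sub>v col Z j = 0\<^sub>v d"
      using col_mult2[OF S(1) ZW(1) j] ZW(5) j by simp
    then have 0: "\<And>i. i < d \<Longrightarrow> \<phi> \<bullet> act A (monom 1 i) (col Z j) = 0"
      using ker[OF c] by blast
    show "\<phi> \<bullet> act A f (col Z j) = 0" for f
      using cyclic_pair_kernel[OF c 0] .
    show "act A P (col Z j) = 0\<^sub>v n"
      using cyclic_pair_annihilates_kernel[OF P c 0] .
  qed
  have SAZ: "S * (A * Z) = 0\<^sub>m d ?m"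
  proof (rule mat_col_eqI)
    fix j assume "j < dim_col (0\<^sub>m d ?m :: 'a mat)"
    then have j: "j < ?m" by simp
    have AZ: "A * Z \<in> carrier_mat n ?m" using A ZW by simp
    have "col (S * (A * Z)) j = S *\<^sub>v (A *\<^sub>v col Z j)"
      using col_mult2[OF S(1) AZ j] col_mult2[OF A ZW(1) j] by simp
    also have "A *\<^sub>v col Z j = act A [:0, 1:] (col Z j)"
      by (simp add: act_def mat_poly_X[OF A])
    also have "S *\<^sub>v \<dots> = 0\<^sub>v d"
      using ker[OF act_carrier[OF colZ(1)[OF j]]] colZ(1,2)[OF j] by (simp flip: act_mult_poly)
    finally show "col (S * (A * Z)) j = col (0\<^sub>m d ?m) j" using j by simp
  qed (use S ZW A in auto)
  have PZ: "mat_poly P A * Z = 0\<^sub>m n ?m"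
  proof (rule mat_col_eqI)
    fix j assume "j < dim_col (0\<^sub>m n ?m :: 'a mat)"
    then have j: "j < ?m" by simp
    show "col (mat_poly P A * Z) j = col (0\<^sub>m n ?m) j"
      using col_mult2[OF mat_poly_carrier[OF A] ZW(1) j, of P] colZ(3)[OF j] j by (simp add: act_def)
  qed (use ZW A in auto)
  have AT: "A * ?T = ?T * companion_mat P"
    using krylov_companion_mat[OF x P(1)] P by simp
  have CP: "companion_mat P \<in> carrier_mat d d" using P(2) by auto
  \<comment> \<open>\<open>W\<close> reads coordinates with respect to the columns of
    \<open>Z\<close>, so \<open>B\<close> is the restriction of \<open>A\<close> to the complement;
    \<open>SAZ\<close> says that this complement is invariant.\<close>
  define B where "B = W * (A * Z)"
  have B: "B \<in> carrier_mat ?m ?m" using A ZW by (simp add: B_def)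
  have "(?T * S + Z * W) * (A * Z) = Z * B"
    using S ZW(1,2) A SAZ by (simp add: B_def mat_dim)
  then have AZ: "A * Z = Z * B"
    unfolding ZW(3) using A ZW(1) by (simp add: mat_dim)
  have "mat_poly P B = W * (Z * mat_poly P B)"
    using ZW B by (simp add: cancel_left_dim)
  also have "Z * mat_poly P B = 0\<^sub>m n ?m"
    using mat_poly_intertwine[OF A B ZW(1) AZ, of P] PZ by simp
  finally have PB: "mat_poly P B = 0\<^sub>m ?m ?m" using ZW by (simp add: mat_dim)
  define U V where "U = append_cols Z ?T" and "V = W @\<^sub>r S"
  let ?D = "four_block_mat B (0\<^sub>m ?m d) (0\<^sub>m d ?m) (companion_mat P)"
  have nd: "?m + d = n" using dn by simp
  have UV: "U \<in> carrier_mat n n" "V \<in> carrier_mat n n"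
    using ZW(1,2) S(1) T nd by (auto simp: U_def V_def)
  have "U * V = Z * W + ?T * S"
    unfolding U_def V_def using ZW(1,2) S(1) A by (intro append_cols_mult_append_rows) auto
  also have "\<dots> = 1\<^sub>m n"
    unfolding ZW(3)[symmetric] using ZW(1,2) S(1) A by (intro comm_add_mat[of _ n n] carrier_matI) auto
  finally have UV1: "U * V = 1\<^sub>m n" .
  then have VU1: "V * U = 1\<^sub>m n" using mat_mult_left_right_inverse UV by blast
  have "V * (A * U) = four_block_mat (W * (A * Z)) (W * (A * ?T)) (S * (A * Z)) (S * (A * ?T))"
    unfolding U_def V_def using ZW(1,2) S(1) A
    by (subst mult_append_cols) (auto intro!: append_rows_mult_append_cols)
  also have "W * (A * ?T) = 0\<^sub>m ?m d"
  proof -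
    have "W * (A * ?T) = W * ?T * companion_mat P"
      unfolding AT using ZW(2) CP A by (simp add: mat_dim)
    then show ?thesis unfolding ZW(6) using CP by (simp add: mat_dim)
  qed
  also have "S * (A * ?T) = companion_mat P"
    unfolding AT using S CP A by (simp add: cancel_left_dim)
  also have "S * (A * Z) = 0\<^sub>m d ?m" by (rule SAZ)
  finally have VAU: "V * (A * U) = ?D" unfolding B_def .
  have "U * (V * (A * U)) * V = U * V * A * (U * V)"
    using UV A by (simp add: mat_dim)
  then have "A = U * ?D * V"
    unfolding VAU UV1 using A by (simp add: mat_dim)
  then have "similar_mat A ?D"
    using A UV UV1 VU1 B CP nd by (intro similar_matI[of _ _ U V n]) auto
  then show thesis
    using that[of P B] P d dn B PB by simp
qed

end

end

lemma cyclic_decomposition: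
  fixes A :: "'a :: field mat"
  assumes A: "A \<in> carrier_mat n n" and n: "n > 0"
  obtains P B where "lead_coeff P = 1" "0 < degree P" "degree P \<le> n"
    "B \<in> carrier_mat (n - degree P) (n - degree P)"
    "similar_mat A (four_block_mat B (0\<^sub>m (n - degree P) (degree P)) (0\<^sub>m (degree P) (n - degree P)) (companion_mat P))"
    "mat_poly P B = 0\<^sub>m (n - degree P) (n - degree P)"
proof -
  \<comment> \<open>The shift to \<open>Suc k\<close> excludes length 0, for which the condition on
    a pair holds trivially and no block would be split off.\<close>
  define C where "C k \<longleftrightarrow> (\<exists>x \<phi>. cyclic_pair A (Suc k) x \<phi>)" for k
  have "cyclic_pair A 1 (unit_vec n 0) (unit_vec n 0)"
    using A n by (intro cyclic_pairI[OF A]) (auto simp: act_def mat_poly_1 monom_0 simp flip: one_pCons)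
  then have "C 0" unfolding C_def One_nat_def by blast
  moreover have "\<not> C n" using cyclic_pair_le[OF A] unfolding C_def by fastforce
  ultimately obtain k where "C k" "\<not> C (Suc k)"
    using nat_induct[of C n] by blast
  then obtain d x \<phi> where d: "d > 0" and cp: "cyclic_pair A d x \<phi>"
    and max: "\<And>x \<phi>. \<not> cyclic_pair A (Suc d) x \<phi>"
    unfolding C_def by blast
  have At: "transpose_mat A \<in> carrier_mat n n" using A by simp
  have "\<not> cyclic_pair (transpose_mat A) (Suc d) \<phi> \<psi>" for \<psi>
    using cyclic_pair_transpose[OF At, of "Suc d" \<phi> \<psi>] max by auto
  then obtain R where "lead_coeff R = 1" "degree R = d" "act (transpose_mat A) R \<phi> = 0\<^sub>v n"
    using cyclic_pair_annihilator[OF At cyclic_pair_transpose[OF A cp]] by metis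
  from cyclic_decomposition_aux[OF A cp d max this] that show thesis by metis
qed

section \<open>Assembling the list of invariant factors\<close>

lemma companion_diag_replicate_1: "companion_diag (replicate k 1 @ Ps) = companion_diag Ps"
proof (induction k)
  case (Suc k)
  have "companion_diag (1 # Qs) = companion_diag Qs" for Qs :: "'a poly list"
    unfolding companion_diag_Cons using companion_diag_carrier[of Qs]
    by (intro eq_matI) (auto simp: companion_mat_def)
  then show ?case using Suc by simp
qed simp

lemma is_invariant_factors_iff_sorted:
  fixes A :: "'a :: field mat"
  shows "is_invariant_factors A Ps \<longleftrightarrow> length Ps = dim_row A \<and> (\<forall>P\<in>set Ps. lead_coeff P = 1) \<and>
     sorted_wrt (dvd) Ps \<and> similar_mat A (companion_diag Ps)"
proof -
  have tr: "transp ((dvd) :: 'a poly \<Rightarrow> _)"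
    by (rule transpI) (rule dvd_trans)
  show ?thesis
    unfolding is_invariant_factors_def sorted_wrt_iff_nth_Suc_transp[OF tr] by blast
qed

text \<open>The rank formula at \<open>P\<close> gives rank 0, so the gcd degrees add up to the sum
  of all degrees. Each gcd degree is therefore the full degree of its factor.\<close>

lemma invariant_factors_dvd_annihilator:
  assumes Ps: "is_invariant_factors A Ps" and A: "A \<in> carrier_mat n n"
    and P: "mat_poly P A = 0\<^sub>m n n" "P \<noteq> 0" and Q: "Q \<in> set Ps"
  shows "Q dvd P"
proof -
  let ?g = "\<lambda>j. gcd_degree (Ps ! j) P" and ?d = "\<lambda>j. degree (Ps ! j)"
  have "has_rank (0\<^sub>m n n :: 'a mat) 0"
    unfolding has_rank_def
    by (intro exI[of _ "0\<^sub>m n 0"] exI[of _ "0\<^sub>m 0 n"]) auto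
  then have "length Ps - sum ?g {..<length Ps} = 0"
    using has_rank_mat_poly[OF Ps, of P] has_rank_unique P(1) by metis
  moreover have le: "?g j \<le> ?d j" if "j < length Ps" for j
    using gcd_degree_le(1) invariant_factors_nz[OF Ps that] by blast
  then have "sum ?g {..<length Ps} \<le> sum ?d {..<length Ps}" by (intro sum_mono) auto
  ultimately have "sum ?g {..<length Ps} = sum ?d {..<length Ps}"
    using sum_degree_invariant_factors[OF Ps] by simp
  then have "?g j = ?d j" if "j < length Ps" for j
    using sum_mono_inv[of ?g "{..<length Ps}" ?d j] le that by simp
  then show ?thesis
    using Q P(2) invariant_factors_nz[OF Ps] gcd_degree_eq(1) unfolding in_set_conv_nth by metis
qed

lemma ex_invariant_factors:
  assumes "A \<in> carrier_mat n n"
  shows "\<exists>Ps. is_invariant_factors A Ps"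
  using assms
proof (induction n arbitrary: A rule: less_induct)
  case (less n)
  show ?case
  proof (cases "n = 0")
    case True
    then have "A = diag_block_mat []" using less.prems by auto
    then have "is_invariant_factors A []"
      using similar_mat_refl[OF less.prems] less.prems True by (auto simp: is_invariant_factors_def)
    then show ?thesis by blast
  next
    case False
    then obtain P B where P: "lead_coeff P = 1" "0 < degree P" "degree P \<le> n"
      and B: "B \<in> carrier_mat (n - degree P) (n - degree P)"
      and sim: "similar_mat A (four_block_mat B (0\<^sub>m (n - degree P) (degree P)) (0\<^sub>m (degree P) (n - degree P)) (companion_mat P))"
      and PB: "mat_poly P B = 0\<^sub>m (n - degree P) (n - degree P)"
      using cyclic_decomposition[OF less.prems] by blast
    obtain Qs where Qs: "is_invariant_factors B Qs"
      using less.IH[OF _ B] P False by auto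
    have dvd: "Q dvd P" if "Q \<in> set Qs" for Q
      using invariant_factors_dvd_annihilator[OF Qs B PB] P that by fastforce
    have simB: "similar_mat B (companion_diag Qs)" using Qs by (simp add: is_invariant_factors_def)
    then have D: "companion_diag Qs \<in> carrier_mat (n - degree P) (n - degree P)"
      using similar_matE[OF _ B] by metis
    have "companion_diag (Qs @ [P]) = four_block_mat (companion_diag Qs) (0\<^sub>m (n - degree P) (degree P))
        (0\<^sub>m (degree P) (n - degree P)) (companion_mat P)"
      unfolding map_append list.map diag_block_mat_last Let_def carrier_matD[OF D]
        carrier_matD[OF companion_mat_carrier] ..
    then have "similar_mat A (companion_diag (Qs @ [P]))"
      using similar_mat_trans[OF sim
          similar_mat_four_block_0_0[OF simB similar_mat_refl[OF companion_mat_carrier] B companion_mat_carrier]]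
      by (simp only:)
    \<comment> \<open>The companion matrix of 1 is empty. As \<open>Qs @ [P]\<close> has
      \<open>n - degree P + 1\<close> entries, \<open>degree P - 1\<close> ones bring the length to
      \<open>n\<close>.\<close>
    then have "similar_mat A (companion_diag (replicate (degree P - 1) 1 @ Qs @ [P]))"
      by (simp only: companion_diag_replicate_1)
    moreover have "sorted_wrt (dvd) (replicate k (1 :: 'a poly))" for k
      by (induction k) auto
    ultimately have "is_invariant_factors A (replicate (degree P - 1) 1 @ Qs @ [P])"
      using Qs B P less.prems dvd
      unfolding is_invariant_factors_iff_sorted by (auto simp: sorted_wrt_append)
    then show ?thesis by blast
  qed
qed

section \<open>Products of a nilpotent and an idempotent matrix\<close>

definition nilpotent_idempotent_product :: "'a :: field mat \<Rightarrow> bool" where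
  "nilpotent_idempotent_product A \<longleftrightarrow> (\<exists>N \<in> carrier_mat (dim_row A) (dim_row A).
     \<exists>V \<in> carrier_mat (dim_row A) (dim_row A). nilpotent_mat N \<and> idempotent_mat V \<and> A = N * V)"

lemma add_assoc_dim:
  fixes A :: "'a :: semigroup_add mat"
  shows "dim_row A = dim_row C \<Longrightarrow> dim_col A = dim_col C \<Longrightarrow> dim_row B = dim_row C \<Longrightarrow>
    dim_col B = dim_col C \<Longrightarrow> A + B + C = A + (B + C)"
  by (intro eq_matI) (auto simp: add.assoc)

lemma idempotent_mat_iff:
  assumes "V \<in> carrier_mat n n"
  shows "idempotent_mat V \<longleftrightarrow> V * V = V"
  using assms by (auto simp: idempotent_mat_def numeral_2_eq_2)

lemma nilpotent_mat_iff:
  assumes "N \<in> carrier_mat n n"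
  shows "nilpotent_mat N \<longleftrightarrow> (\<exists>k. N ^\<^sub>m k = 0\<^sub>m n n)"
  using assms by (auto simp: nilpotent_mat_def)

lemma pow_mat_zero_mono:
  fixes N :: "'a :: semiring_1 mat"
  assumes "N \<in> carrier_mat n n" "N ^\<^sub>m k = 0\<^sub>m n n" "k \<le> l"
  shows "N ^\<^sub>m l = 0\<^sub>m n n"
  using assms(3) by (induction l rule: dec_induct) (use assms in \<open>auto simp: mat_dim\<close>)

text \<open>\<open>N\<close> shifts rows down by one, so row \<open>i\<close> of \<open>V\<close>
  must be row \<open>i + 1\<close> of the companion matrix. The last row of \<open>V\<close> is lost
  in the product and is set to 0 to make \<open>V\<close> idempotent. The product has top row 0,
  which is where the root of \<open>P\<close> enters.\<close>

lemma companion_mat_product: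
  fixes P :: "'a :: field poly"
  assumes "poly P 0 = 0"
  shows "nilpotent_idempotent_product (companion_mat P)"
proof -
  let ?d = "degree P"
  define N where "N = companion_mat (monom 1 ?d :: 'a poly)"
  define V where "V = mat ?d ?d (\<lambda>(i, j). if i = ?d - 1 then 0
    else if j = ?d - 1 then - coeff P (Suc i) else if i = j then 1 else 0)"
  have lead: "lead_coeff (monom 1 ?d :: 'a poly) = 1" by (simp add: degree_monom_eq)
  have N: "N \<in> carrier_mat ?d ?d"
    using companion_mat_carrier[of "monom (1 :: 'a) ?d"] by (simp add: N_def degree_monom_eq)
  have V: "V \<in> carrier_mat ?d ?d" by (simp add: V_def)
  have N_index: "N $$ (i, j) = (if i = Suc j then 1 else 0)" if "i < ?d" "j < ?d" for i j
    using that by (auto simp: N_def companion_mat_def degree_monom_eq)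
  have "N ^\<^sub>m ?d = mat_poly (monom 1 ?d) N"
    unfolding mat_poly_X_pow[OF N, symmetric] by (simp add: monom_altdef)
  also have "\<dots> = 0\<^sub>m ?d ?d"
    unfolding N_def mat_poly_companion_mat[OF lead]
    by (intro eq_matI) (auto simp: degree_monom_eq poly_map_mat_def functional_mat_def)
  finally have "nilpotent_mat N" using nilpotent_mat_iff[OF N] by blast
  moreover have "V * V = V"
  proof (rule eq_matI)
    fix i j assume "i < dim_row V" "j < dim_col V"
    then have ij: "i < ?d" "j < ?d" using V by auto
    have "(V * V) $$ (i, j) = (\<Sum>k = 0..<?d. V $$ (i, k) * V $$ (k, j))"
      using ij V by (simp add: scalar_prod_def)
    \<comment> \<open>Off the diagonal, row \<open>i\<close> of \<open>V\<close> can be nonzero only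
      in the last column, and that entry meets the zero last row of \<open>V\<close>.\<close>
    also have "\<dots> = (\<Sum>k = 0..<?d. if k = i then V $$ (i, j) else 0)"
      using ij by (intro sum.cong) (auto simp: V_def)
    also have "\<dots> = V $$ (i, j)" using ij by simp
    finally show "(V * V) $$ (i, j) = V $$ (i, j)" .
  qed auto
  moreover have "companion_mat P = N * V"
  proof (rule eq_matI)
    fix i j assume "i < dim_row (N * V)" "j < dim_col (N * V)"
    then have ij: "i < ?d" "j < ?d" using N V by auto
    have "(N * V) $$ (i, j) = (\<Sum>k = 0..<?d. N $$ (i, k) * V $$ (k, j))"
      using ij N V by (simp add: scalar_prod_def)
    also have "\<dots> = (\<Sum>k = 0..<?d. if Suc k = i then V $$ (k, j) else 0)"
      using ij by (intro sum.cong) (auto simp: N_index)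
    also have "\<dots> = (if i = 0 then 0 else V $$ (i - 1, j))"
    proof (cases i)
      case (Suc k)
      then have "(\<Sum>l = 0..<?d. if Suc l = i then V $$ (l, j) else 0) = (\<Sum>l = 0..<?d. if l = k then V $$ (k, j) else 0)"
        by (intro sum.cong) auto
      then show ?thesis using Suc ij by simp
    qed simp
    also have "\<dots> = companion_mat P $$ (i, j)"
      using ij assms by (cases i) (auto simp: V_def companion_mat_def poly_0_coeff_0)
    finally show "companion_mat P $$ (i, j) = (N * V) $$ (i, j)" by simp
  qed (use N V in \<open>auto simp: companion_mat_def\<close>)
  ultimately show ?thesis
    using N V idempotent_mat_iff[OF V] unfolding nilpotent_idempotent_product_def
    by (auto simp: companion_mat_def)
qed

lemma nilpotent_idempotent_product_four_block:
  assumes "nilpotent_idempotent_product A" "nilpotent_idempotent_product B"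
    and A: "A \<in> carrier_mat n n" and B: "B \<in> carrier_mat m m"
  shows "nilpotent_idempotent_product (four_block_mat A (0\<^sub>m n m) (0\<^sub>m m n) B)"
proof -
  obtain N V where N: "N \<in> carrier_mat n n" "nilpotent_mat N" and V: "V \<in> carrier_mat n n" "idempotent_mat V"
    and A_eq: "A = N * V"
    using assms(1) A by (auto simp: nilpotent_idempotent_product_def)
  obtain N' V' where N': "N' \<in> carrier_mat m m" "nilpotent_mat N'" and V': "V' \<in> carrier_mat m m" "idempotent_mat V'"
    and B_eq: "B = N' * V'"
    using assms(2) B by (auto simp: nilpotent_idempotent_product_def)
  obtain k k' where k: "N ^\<^sub>m k = 0\<^sub>m n n" "N' ^\<^sub>m k' = 0\<^sub>m m m"
    using N N' nilpotent_mat_iff by metis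
  have k_max: "N ^\<^sub>m max k k' = 0\<^sub>m n n" "N' ^\<^sub>m max k k' = 0\<^sub>m m m"
    using pow_mat_zero_mono[OF N(1) k(1)] pow_mat_zero_mono[OF N'(1) k(2)] by auto
  let ?D = "\<lambda>X Y. four_block_mat X (0\<^sub>m n m) (0\<^sub>m m n) Y"
  have mult: "?D X Y * ?D X' Y' = ?D (X * X') (Y * Y')"
    if "X \<in> carrier_mat n n" "Y \<in> carrier_mat m m" "X' \<in> carrier_mat n n" "Y' \<in> carrier_mat m m" for X Y X' Y' :: "'a mat"
    using that by (subst mult_four_block_mat[of _ n n _ m _ m _ _ n _ m]) (auto simp: mat_dim)
  have c: "?D N N' \<in> carrier_mat (n + m) (n + m)" "?D V V' \<in> carrier_mat (n + m) (n + m)"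
    using N N' V V' by auto
  have "?D N N' ^\<^sub>m max k k' = 0\<^sub>m (n + m) (n + m)"
    using pow_four_block_mat[OF N(1) N'(1)] k_max by simp
  then have "nilpotent_mat (?D N N')" using nilpotent_mat_iff[OF c(1)] by blast
  moreover have "idempotent_mat (?D V V')"
    unfolding idempotent_mat_iff[OF c(2)] mult[OF V(1) V'(1) V(1) V'(1)]
    using V V' by (simp add: idempotent_mat_iff)
  moreover have "?D A B = ?D N N' * ?D V V'"
    unfolding A_eq B_eq using N N' V V' by (simp add: mult)
  moreover have "?D A B \<in> carrier_mat (n + m) (n + m)" using A B by simp
  ultimately show ?thesis
    using c unfolding nilpotent_idempotent_product_def by (metis carrier_matD(1))
qed

lemma nilpotent_idempotent_product_companion_diag:
  assumes "\<And>P. P \<in> set Ps \<Longrightarrow> nilpotent_idempotent_product (companion_mat P)"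
  shows "nilpotent_idempotent_product (companion_diag Ps)"
  using assms
proof (induction Ps)
  case Nil
  have c: "0\<^sub>m 0 0 \<in> carrier_mat 0 0" by simp
  have "nilpotent_mat (0\<^sub>m 0 0 :: 'a mat)" "idempotent_mat (0\<^sub>m 0 0 :: 'a mat)"
    unfolding nilpotent_mat_iff[OF c] idempotent_mat_iff[OF c] by (auto intro: exI[of _ 1])
  then show ?case by (auto simp: nilpotent_idempotent_product_def intro!: bexI[of _ "0\<^sub>m 0 0"])
next
  case (Cons P Ps)
  then show ?case
    unfolding companion_diag_Cons
    by (intro nilpotent_idempotent_product_four_block) auto
qed

lemma nilpotent_idempotent_product_similar:
  assumes "similar_mat A B" "A \<in> carrier_mat n n" "nilpotent_idempotent_product B"
  shows "nilpotent_idempotent_product A"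
proof -
  obtain S T where ST: "S \<in> carrier_mat n n" "T \<in> carrier_mat n n" and B: "B \<in> carrier_mat n n"
    and inv: "S * T = 1\<^sub>m n" "T * S = 1\<^sub>m n" and A: "A = S * B * T"
    using similar_matE[OF assms(1,2)] by metis
  obtain N V where N: "N \<in> carrier_mat n n" "nilpotent_mat N" and V: "V \<in> carrier_mat n n" "idempotent_mat V"
    and B_eq: "B = N * V"
    using assms(3) B by (auto simp: nilpotent_idempotent_product_def)
  obtain k where k: "N ^\<^sub>m k = 0\<^sub>m n n" using N nilpotent_mat_iff by metis
  let ?N = "S * N * T" and ?V = "S * V * T"
  have c: "?N \<in> carrier_mat n n" "?V \<in> carrier_mat n n" using ST N V by auto
  have "similar_mat_wit ?N N S T"
    using ST N c inv by (intro similar_mat_witI[of _ _ n]) auto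
  then have "?N ^\<^sub>m k = S * N ^\<^sub>m k * T" by (rule similar_mat_wit_pow_id)
  then have "?N ^\<^sub>m k = 0\<^sub>m n n" using ST k by (simp add: mat_dim)
  then have "nilpotent_mat ?N" using nilpotent_mat_iff[OF c(1)] by blast
  moreover have "?V * ?V = S * (V * V) * T"
    using ST V(1) inv by (simp add: mat_dim cancel_left_dim)
  then have "idempotent_mat ?V"
    using V idempotent_mat_iff[OF V(1)] idempotent_mat_iff[OF c(2)] by simp
  moreover have "A = ?N * ?V"
    unfolding A B_eq using ST V(1) N(1) inv by (simp add: mat_dim cancel_left_dim)
  ultimately show ?thesis
    unfolding nilpotent_idempotent_product_def carrier_matD[OF assms(2)] using c by blast
qed

section \<open>The dimension count\<close>

text \<open>The juxtaposition of \<open>U\<close>, \<open>A * U\<close>, ..., up to the power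
  \<open>m - 1\<close> of \<open>A\<close>: its columns span what the columns of \<open>U\<close>
  generate under polynomials of degree less than \<open>m\<close>.\<close>

fun block_krylov :: "'a :: field mat \<Rightarrow> 'a mat \<Rightarrow> nat \<Rightarrow> 'a mat" where
  "block_krylov A U 0 = 0\<^sub>m (dim_row A) 0"
| "block_krylov A U (Suc m) = append_cols U (A * block_krylov A U m)"

context
  fixes A U :: "'a :: field mat" and n k :: nat
  assumes A: "A \<in> carrier_mat n n" and U: "U \<in> carrier_mat n k"
begin

lemma block_krylov_carrier [simp, intro]: "block_krylov A U m \<in> carrier_mat n (m * k)"
  using A U by (induction m) auto

lemma block_krylov_span:
  assumes "deg_lt m f"
  shows "\<exists>H \<in> carrier_mat (m * k) k. mat_poly f A * U = block_krylov A U m * H"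
  using assms
proof (induction m arbitrary: f)
  case 0
  then have "f = 0" by (auto simp: deg_lt_def intro: poly_eqI)
  then show ?case
    using A U by (intro bexI[of _ "0\<^sub>m 0 k"]) (auto simp: mat_dim)
next
  case (Suc m)
  obtain a g where f: "f = pCons a g" by (cases f)
  have "deg_lt m g" unfolding deg_lt_def
  proof (intro allI impI)
    fix i assume "m \<le> i"
    then have "coeff f (Suc i) = 0" using Suc.prems by (simp add: deg_lt_def)
    then show "coeff g i = 0" by (simp add: f)
  qed
  then obtain H where H: "H \<in> carrier_mat (m * k) k" "mat_poly g A * U = block_krylov A U m * H"
    using Suc.IH by blast
  note K = block_krylov_carrier[of m]
  have "mat_poly f A * U = a \<cdot>\<^sub>m U + A * (mat_poly g A * U)"
    unfolding f mat_poly_pCons[OF A] using A U by (simp add: mat_dim smult_mult_dim)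
  also have "a \<cdot>\<^sub>m U = U * (a \<cdot>\<^sub>m 1\<^sub>m k)"
    using U by (simp add: smult_mult_dim)
  also have "A * (mat_poly g A * U) = A * block_krylov A U m * H"
    unfolding H(2) using A carrier_matD[OF K] H(1) by (simp add: mat_dim)
  also have "U * (a \<cdot>\<^sub>m 1\<^sub>m k) + \<dots> = block_krylov A U (Suc m) * ((a \<cdot>\<^sub>m 1\<^sub>m k) @\<^sub>r H)"
    unfolding block_krylov.simps using A U carrier_matD[OF K] H(1)
    by (intro append_cols_mult_append_rows[symmetric]) auto
  finally show ?case
    using H(1) by (intro bexI[of _ "(a \<cdot>\<^sub>m 1\<^sub>m k) @\<^sub>r H"]) auto
qed

text \<open>Division by \<open>P\<close> leaves only \<open>f mod P\<close> modulo the image of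
  \<open>mat_poly P A\<close>. So \<open>degree P\<close> blocks suffice for all \<open>f\<close>,
  in particular for arbitrarily high powers of \<open>A\<close>.\<close>

lemma block_krylov_span_mod:
  assumes "P \<noteq> 0"
  shows "\<exists>G \<in> carrier_mat n k. \<exists>H \<in> carrier_mat (degree P * k) k.
    mat_poly f A * U = mat_poly P A * G + block_krylov A U (degree P) * H"
proof -
  obtain H where H: "H \<in> carrier_mat (degree P * k) k"
    "mat_poly (f mod P) A * U = block_krylov A U (degree P) * H"
    using block_krylov_span[OF deg_lt_mod[OF assms]] by blast
  have "mat_poly f A * U = mat_poly (P * (f div P) + f mod P) A * U" by simp
  also have "\<dots> = mat_poly P A * (mat_poly (f div P) A * U) + mat_poly (f mod P) A * U"
    unfolding mat_poly_add[OF A] mat_poly_mult[OF A] using A U by (simp add: mat_dim)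
  finally show ?thesis
    using H A U by (intro bexI[of _ "mat_poly (f div P) A * U"] bexI[of _ H]) auto
qed

text \<open>\<^term>\<open>A ^\<^sub>m q - N ^\<^sub>m q\<close> is the sum of all \<^term>\<open>A ^\<^sub>m i * (A - N) * N ^\<^sub>m (q - 1 - i)\<close>.\<close>

lemma pow_mat_perturbation:
  assumes P: "P \<noteq> 0" and N: "N \<in> carrier_mat n n" and W: "W \<in> carrier_mat k n" and A_eq: "A = N + U * W"
  shows "\<exists>G \<in> carrier_mat n n. \<exists>H \<in> carrier_mat (degree P * k) n.
    A ^\<^sub>m q = N ^\<^sub>m q + (mat_poly P A * G + block_krylov A U (degree P) * H)"
proof (induction q)
  case 0
  have "A ^\<^sub>m 0 = N ^\<^sub>m 0 + (mat_poly P A * 0\<^sub>m n n + block_krylov A U (degree P) * 0\<^sub>m (degree P * k) n)"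
    using A N carrier_matD[OF block_krylov_carrier] by (simp add: mat_dim)
  then show ?case by (meson zero_carrier_mat)
next
  case (Suc q)
  let ?K = "block_krylov A U (degree P)"
  obtain G H where GH: "G \<in> carrier_mat n n" "H \<in> carrier_mat (degree P * k) n"
    and IH: "A ^\<^sub>m q = N ^\<^sub>m q + (mat_poly P A * G + ?K * H)"
    using Suc by blast
  obtain G' H' where GH': "G' \<in> carrier_mat n k" "H' \<in> carrier_mat (degree P * k) k"
    and U_eq: "A ^\<^sub>m q * U = mat_poly P A * G' + ?K * H'"
    using block_krylov_span_mod[OF P, of "[:0, 1:] ^ q"] unfolding mat_poly_X_pow[OF A] by blast
  have d: "dim_row A = n" "dim_col A = n" "dim_row N = n" "dim_col N = n" "dim_row U = n" "dim_col U = k"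
    "dim_row W = k" "dim_col W = n" "dim_row ?K = n" "dim_col ?K = degree P * k"
    "dim_row G = n" "dim_col G = n" "dim_row H = degree P * k" "dim_col H = n"
    "dim_row G' = n" "dim_col G' = k" "dim_row H' = degree P * k" "dim_col H' = k"
    "dim_row (A ^\<^sub>m q) = n" "dim_col (A ^\<^sub>m q) = n" "dim_row (N ^\<^sub>m q) = n" "dim_col (N ^\<^sub>m q) = n"
    "dim_row (mat_poly P A) = n" "dim_col (mat_poly P A) = n"
    using A N U W GH GH' carrier_matD[OF block_krylov_carrier] by auto
  \<comment> \<open>Splitting off the last factor keeps the shape: the part with \<open>N\<close>
    inherits it from the induction hypothesis, and in the part with \<open>U * W\<close> the span
    lemma absorbs \<open>A ^\<^sub>m q * U\<close>.\<close>
  have "A ^\<^sub>m Suc q = A ^\<^sub>m q * (N + U * W)"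
    by (simp add: A_eq[symmetric])
  also have "\<dots> = A ^\<^sub>m q * N + A ^\<^sub>m q * U * W"
    using d by (simp add: mat_dim del: index_mult_mat(1))
  also have "A ^\<^sub>m q * N = N ^\<^sub>m q * N + (mat_poly P A * (G * N) + ?K * (H * N))"
    unfolding IH using d by (simp add: mat_dim del: index_mult_mat(1))
  also have "A ^\<^sub>m q * U * W = mat_poly P A * (G' * W) + ?K * (H' * W)"
    unfolding U_eq using d by (simp add: mat_dim del: index_mult_mat(1))
  also have "N ^\<^sub>m q * N + (mat_poly P A * (G * N) + ?K * (H * N)) + \<dots> =
      N ^\<^sub>m q * N + (mat_poly P A * (G * N) + mat_poly P A * (G' * W) + (?K * (H * N) + ?K * (H' * W)))"
    using d by (intro eq_matI) (simp_all add: algebra_simps del: index_mult_mat(1))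
  also have "\<dots> = N ^\<^sub>m Suc q + (mat_poly P A * (G * N + G' * W) + ?K * (H * N + H' * W))"
    using d by (simp add: mat_dim del: index_mult_mat(1))
  finally show ?case
    using GH GH' N W by (intro bexI[of _ "G * N + G' * W"] bexI[of _ "H * N + H' * W"]) auto
qed

text \<open>With nonzero constant term, \<open>P\<close> is coprime to every power of the variable,
  so 1 is a combination of \<open>P\<close> and the q-th power. Evaluated at \<open>A\<close>, with
  \<open>N ^\<^sub>m q\<close> zero, this writes the identity as a product through a matrix with
  \<open>r + degree P * k\<close> columns.\<close>

lemma nilpotent_perturbation_rank_bound:
  assumes P: "P \<noteq> 0" "poly P 0 \<noteq> 0" and N: "N \<in> carrier_mat n n" "nilpotent_mat N"
    and W: "W \<in> carrier_mat k n" and A_eq: "A = N + U * W" and r: "has_rank (mat_poly P A) r"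
  shows "n \<le> r + degree P * k"
proof -
  let ?K = "block_krylov A U (degree P)" and ?m = "degree P * k"
  obtain q where q: "N ^\<^sub>m q = 0\<^sub>m n n" using N nilpotent_mat_iff by metis
  obtain G H where GH: "G \<in> carrier_mat n n" "H \<in> carrier_mat ?m n"
    and Aq: "A ^\<^sub>m q = N ^\<^sub>m q + (mat_poly P A * G + ?K * H)"
    using pow_mat_perturbation[OF P(1) N(1) W A_eq] by blast
  have "\<exists>u v. 1 = P * u + [:0, 1:] ^ q * v"
  proof (induction q)
    case 0
    have "1 = P * 0 + [:0, 1:] ^ 0 * 1" by simp
    then show ?case by blast
  next
    case (Suc q)
    then obtain u v where uv: "1 = P * u + [:0, 1:] ^ q * v" by blast
    obtain a g where ag: "P = pCons a g" by (cases P)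
    have "a \<noteq> 0" using P(2) ag by simp
    \<comment> \<open>\<open>c\<close> inverts the constant term \<open>a\<close>. Multiplying the
      term with the q-th power by \<open>c * (P - [:0, 1:] * g)\<close>, which is 1, yields a
      multiple of \<open>P\<close> and one more factor \<open>[:0, 1:]\<close>.\<close>
    define c where "c = [:inverse a:]"
    have "P = [:a:] + [:0, 1:] * g" by (simp add: ag)
    then have "c * (P - [:0, 1:] * g) = 1" using \<open>a \<noteq> 0\<close> by (simp add: c_def one_pCons)
    then have "1 = P * u + [:0, 1:] ^ q * v * (c * (P - [:0, 1:] * g))"
      using uv by simp
    also have "\<dots> = P * (u + [:0, 1:] ^ q * v * c) + [:0, 1:] ^ Suc q * (- (v * c * g))"
    proof -
      have "P * u + x * v * (c * (P - y * g)) = P * (u + x * v * c) + y * x * (- (v * c * g))" for x y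
        by (simp add: algebra_simps)
      then show ?thesis unfolding power_Suc .
    qed
    finally show ?case by blast
  qed
  then obtain u v where uv: "1 = P * u + [:0, 1:] ^ q * v" by blast
  obtain X Y L R where X: "X \<in> carrier_mat n r" and Y: "Y \<in> carrier_mat r n" and PXY: "mat_poly P A = X * Y"
    using has_rankE[OF r mat_poly_carrier[OF A]] by metis
  let ?u = "mat_poly u A" and ?v = "mat_poly v A"
  have uv_c: "?u \<in> carrier_mat n n" "?v \<in> carrier_mat n n" using A by auto
  note K = block_krylov_carrier[of "degree P"]
  have PA: "mat_poly P A \<in> carrier_mat n n" using A by simp
  have "1\<^sub>m n = mat_poly (P * u + [:0, 1:] ^ q * v) A"
    unfolding uv[symmetric] mat_poly_1[OF A] ..
  also have "\<dots> = mat_poly P A * ?u + A ^\<^sub>m q * ?v"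
    by (simp only: mat_poly_add[OF A] mat_poly_mult[OF A] mat_poly_X_pow[OF A])
  also have "A ^\<^sub>m q = mat_poly P A * G + ?K * H"
    unfolding Aq q by (intro left_add_zero_mat add_carrier_mat mult_carrier_mat[OF K GH(2)])
  also have "mat_poly P A * ?u + \<dots> * ?v = mat_poly P A * (?u + G * ?v) + ?K * (H * ?v)"
    using GH carrier_matD[OF K] A uv_c by (simp add: mat_dim add_assoc_dim)
  also have "mat_poly P A * (?u + G * ?v) = X * (Y * (?u + G * ?v))"
    unfolding PXY using X Y GH uv_c by (intro mult_assoc_dim) auto
  also have "\<dots> + ?K * (H * ?v) = append_cols X ?K * ((Y * (?u + G * ?v)) @\<^sub>r (H * ?v))"
    using X Y GH carrier_matD[OF K] uv_c by (intro append_cols_mult_append_rows[symmetric]) auto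
  finally have "append_cols X ?K * ((Y * (?u + G * ?v)) @\<^sub>r (H * ?v)) = 1\<^sub>m n" by simp
  then show ?thesis
    using X Y GH uv_c carrier_append_cols[OF X K]
    by (intro one_mat_factor_le[of "append_cols X ?K" n _ "(Y * (?u + G * ?v)) @\<^sub>r (H * ?v)"]) auto
qed

end

section \<open>Necessity of the root at zero\<close>

lemma first_nontrivial_invariant_factor_root:
  assumes Ps: "is_invariant_factors A Ps" and A: "A \<in> carrier_mat n n"
    and prod: "nilpotent_idempotent_product A"
    and v: "v < n" "Ps ! v \<noteq> 1" "\<And>j. j < v \<Longrightarrow> Ps ! j = 1"
  shows "poly (Ps ! v) 0 = 0"
proof (rule ccontr)
  let ?P = "Ps ! v" and ?X = "[:0, 1:] :: 'a poly"
  assume P0: "poly ?P 0 \<noteq> 0"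
  have len: "length Ps = n" using Ps A by (simp add: is_invariant_factors_def)
  have nz: "Ps ! j \<noteq> 0" if "j < n" for j using invariant_factors_nz[OF Ps] that len by simp
  have m: "degree ?P > 0"
    using invariant_factors_monic[OF Ps, of v] v len by (metis gr0I degree_eq_zeroE coeff_pCons_0 degree_pCons_0 one_pCons)
  \<comment> \<open>The index \<open>v\<close> counts from 0, so \<open>n - v\<close> factors are
    nontrivial. The factors before \<open>v\<close> are 1 and the one at \<open>v\<close> is assumed
    not to vanish at 0, so the nullity of \<open>A\<close> is at most \<open>n - Suc v\<close>, one
    less.\<close>
  have "gcd_degree (Ps ! j) ?X \<le> (if v < j then 1 else 0)" if "j < n" for j
  proof -
    consider "j < v" | "j = v" | "v < j" by linarith
    then show ?thesis
    proof cases
      case 1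
      then show ?thesis using gcd_degree_le(1)[OF nz[OF that], of ?X] v(3) by simp
    next
      case 2
      have "\<not> ?X dvd ?P" using P0 by (auto elim!: dvdE)
      then have "gcd_degree ?P ?X \<noteq> degree ?X"
        using gcd_degree_eq(2)[OF nz[OF v(1)], of ?X] by simp
      then show ?thesis using 2 gcd_degree_le(2)[OF nz[OF v(1)], of ?X] by simp
    next
      case 3
      then show ?thesis using gcd_degree_le(2)[OF nz[OF that], of ?X] by simp
    qed
  qed
  then have "(\<Sum>j<n. gcd_degree (Ps ! j) ?X) \<le> (\<Sum>j<n. if v < j then 1 else 0)"
    by (intro sum_mono) auto
  moreover have "{..<n} \<inter> {j. v < j} = {v<..<n}" by auto
  then have "(\<Sum>j<n. if v < j then 1 else 0 :: nat) = n - Suc v"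
    by (simp add: sum.If_cases)
  ultimately have sumX: "(\<Sum>j<n. gcd_degree (Ps ! j) ?X) \<le> n - Suc v" by simp
  have rankA: "has_rank A (n - (\<Sum>j<n. gcd_degree (Ps ! j) ?X))"
    using has_rank_mat_poly[OF Ps, of ?X] unfolding mat_poly_X[OF A] len .
  have "(\<Sum>j<n. gcd_degree (Ps ! j) ?P) = (\<Sum>j<n. if v \<le> j then degree ?P else 0)"
  proof (intro sum.cong refl)
    fix j assume "j \<in> {..<n}"
    then have j: "j < n" by simp
    show "gcd_degree (Ps ! j) ?P = (if v \<le> j then degree ?P else 0)"
    proof (cases "v \<le> j")
      case True
      then show ?thesis
        using gcd_degree_eq(2)[OF nz[OF j] nz[OF v(1)]] invariant_factors_dvd[OF Ps True] j len by simp
    next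
      case False
      then show ?thesis using gcd_degree_le(1)[OF nz[OF j], of ?P] v(3)[of j] by simp
    qed
  qed
  moreover have "{..<n} \<inter> {j. v \<le> j} = {v..<n}" by auto
  then have "(\<Sum>j<n. if v \<le> j then degree ?P else 0) = (n - v) * degree ?P"
    by (simp add: sum.If_cases)
  ultimately have sumP: "(\<Sum>j<n. gcd_degree (Ps ! j) ?P) = (n - v) * degree ?P" by simp
  have rankP: "has_rank (mat_poly ?P A) (n - (n - v) * degree ?P)"
    using has_rank_mat_poly[OF Ps, of ?P] unfolding len sumP .
  have le_n: "(n - v) * degree ?P \<le> n"
    using sum_gcd_degree_le[OF Ps, of ?P] unfolding len sumP .
  obtain N V where N: "N \<in> carrier_mat n n" "nilpotent_mat N" and V: "V \<in> carrier_mat n n" "idempotent_mat V"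
    and A_eq: "A = N * V"
    using prod A by (auto simp: nilpotent_idempotent_product_def)
  have VV: "V * V = V" using V idempotent_mat_iff by blast
  obtain s where "has_rank V s" using ex_has_rank by blast
  then obtain X Y L R where XY: "X \<in> carrier_mat n s" "Y \<in> carrier_mat s n"
    "L \<in> carrier_mat s n" "R \<in> carrier_mat n s" and V_eq: "V = X * Y" "L * X = 1\<^sub>m s" "Y * R = 1\<^sub>m s"
    using has_rankE V(1) by metis
  \<comment> \<open>Cancelling the one-sided inverses in the equation for idempotence leaves
    \<open>Y * X\<close> equal to the identity, as the completion requires.\<close>
  have "L * (X * Y * (X * Y)) * R = L * (X * Y) * R"
    using VV unfolding V_eq by simp
  then have "Y * X = 1\<^sub>m s"
    using XY V_eq(2,3) by (simp add: mat_dim cancel_left_dim)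
  then obtain Z W where ZW: "Z \<in> carrier_mat n (n - s)" "W \<in> carrier_mat (n - s) n" "X * Y + Z * W = 1\<^sub>m n"
    and s: "s \<le> n"
    using right_inverse_completion[OF XY(1,2)] by metis
  \<comment> \<open>\<open>A\<close> is the product of \<open>N * X\<close> and \<open>Y\<close>,
    hence passes through size \<open>s\<close>, the rank of \<open>V\<close>.\<close>
  have "n - (\<Sum>j<n. gcd_degree (Ps ! j) ?X) \<le> s"
    using N(1) XY A_eq V_eq by (intro has_rank_le[OF rankA, of "N * X" Y n _ n]) (auto simp: mat_dim)
  then have ns: "n - s \<le> n - Suc v" using sumX by simp
  \<comment> \<open>\<open>Z * W\<close> is the projection complementary to \<open>V\<close>, so
    \<open>N\<close> and \<open>A\<close> differ by a product through size \<open>n - s\<close>; the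
    sign is moved into \<open>?W\<close>.\<close>
  let ?U = "N * Z" and ?W = "(- 1) \<cdot>\<^sub>m W"
  have "N = N * (V + Z * W)" using ZW(3) N(1) by (simp add: V_eq)
  also have "\<dots> = A + ?U * W" using N(1) V(1) ZW(1,2) by (simp add: A_eq mat_dim)
  finally have NA: "N = A + ?U * W" .
  have "A = A + ?U * W + ?U * ?W"
    using A N(1) ZW(1,2) by (intro eq_matI) (auto simp: smult_mult_dim)
  then have "A = N + ?U * ?W" using NA by simp
  then have "n \<le> n - (n - v) * degree ?P + degree ?P * (n - s)"
    using nilpotent_perturbation_rank_bound[of A n ?U "n - s" ?P N ?W] A N ZW(1,2) rankP nz[OF v(1)] P0 by auto
  then have "degree ?P * (n - v) \<le> degree ?P * (n - s)"
    using le_n unfolding mult.commute[of "n - v"] by linarith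
  then have "n - v \<le> n - s" using m by simp
  then show False using ns v(1) by simp
qed

theorem theorem1p2:
  fixes n :: nat and A :: "'a :: field mat"
  assumes "n > 0" and "A \<in> carrier_mat n n"
  shows "(\<exists>N \<in> carrier_mat n n. \<exists>V \<in> carrier_mat n n.
            nilpotent_mat N \<and> idempotent_mat V \<and> A = N * V)
         \<longleftrightarrow> poly (first_nontrivial_invariant_factor A) 0 = 0"
proof -
  obtain Ps where Ps: "is_invariant_factors A Ps" using ex_invariant_factors[OF assms(2)] by blast
  have len: "length Ps = n" using Ps assms by (simp add: is_invariant_factors_def)
  define v where "v = (LEAST v. v < length Ps \<and> Ps ! v \<noteq> 1)"
  have "\<exists>v. v < length Ps \<and> Ps ! v \<noteq> 1"
  proof (rule ccontr)
    assume "\<nexists>v. v < length Ps \<and> Ps ! v \<noteq> 1"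
    then have "(\<Sum>j<length Ps. degree (Ps ! j)) = 0" by simp
    then show False using sum_degree_invariant_factors[OF Ps] len assms(1) by simp
  qed
  then have "v < length Ps \<and> Ps ! v \<noteq> 1" unfolding v_def by (rule LeastI_ex)
  then have v: "v < n" "Ps ! v \<noteq> 1" using len by auto
  have below: "Ps ! j = 1" if "j < v" for j
  proof -
    have "\<not> (j < length Ps \<and> Ps ! j \<noteq> 1)" using that unfolding v_def by (rule not_less_Least)
    then show ?thesis using that v(1) len by simp
  qed
  have first: "first_nontrivial_invariant_factor A = Ps ! v"
    unfolding first_nontrivial_invariant_factor_def invariant_factors_eq[OF Ps] v_def Let_def ..
  have "nilpotent_idempotent_product A \<longleftrightarrow> poly (Ps ! v) 0 = 0"
  proof
    assume "nilpotent_idempotent_product A"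
    then show "poly (Ps ! v) 0 = 0"
      using first_nontrivial_invariant_factor_root[OF Ps assms(2)] v below by blast
  next
    assume root: "poly (Ps ! v) 0 = 0"
    have "nilpotent_idempotent_product (companion_mat P)" if P: "P \<in> set Ps" for P
    proof -
      obtain j where j: "j < n" "P = Ps ! j" using P len by (auto simp: in_set_conv_nth)
      show ?thesis
      proof (cases "j < v")
        case True
        \<comment> \<open>The factor 1 has no root at 0, but its companion matrix is empty, just as
          that of the zero polynomial, which does vanish at 0.\<close>
        have "companion_mat P = companion_mat 0"
          using below[OF True] j by (intro eq_matI) (auto simp: companion_mat_def)
        then show ?thesis using companion_mat_product[of 0] by simp
      next
        case False
        then have "Ps ! v dvd P" using invariant_factors_dvd[OF Ps, of v j] j len by simp
        then have "poly P 0 = 0" using root by (auto elim!: dvdE)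
        then show ?thesis by (rule companion_mat_product)
      qed
    qed
    then have "nilpotent_idempotent_product (companion_diag Ps)"
      by (rule nilpotent_idempotent_product_companion_diag)
    then show "nilpotent_idempotent_product A"
      using nilpotent_idempotent_product_similar[OF _ assms(2)] Ps unfolding is_invariant_factors_def by blast
  qed
  then show ?thesis
    unfolding first nilpotent_idempotent_product_def carrier_matD[OF assms(2)] .
qed

end
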